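(* Let $\nu\ge 0$, $\alpha>0$, and let $f$ be an infinitely differentiable function on $(0,\infty)$ with support $[a,b]$, $0<a<b<\infty$. Then the Mellin transforms of the fractional Bessel integral and of the fractional Bessel derivative of $f$ on the semiaxis have the form $$ (IB_{\nu,-}^{\alpha}f)^*(s)=\frac{1}{2^{2\alpha}}\,\frac{\Gamma\left(\frac s2\right)\Gamma\left(\frac s2-\frac{\nu-1}{2}\right)}{\Gamma\left(\alpha+\frac s2-\frac{\nu-1}{2}\right)\Gamma\left(\alpha+\frac s2\right)}\,f^*(2\alpha+s), $$ $$ (DB_{\nu,-}^{\alpha}f)^*(s)=2^{2\alpha}\,\frac{\Gamma\left(\frac s2\right)\Gamma\left(\frac s2-\frac{\nu-1}{2}\right)}{\Gamma\left(\frac s2-\alpha-\frac{\nu-1}{2}\right)\Gamma\left(\frac s2-\alpha\right)}\,f^*(s-2\alpha). $$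
   Context: For $\nu\ge 0$ the Bessel operator on $(0,\infty)$ is $B_\nu=D^2+\frac{\nu}{x}D$, $D=\frac{d}{dx}$. For $\alpha>0$ the fractional Bessel integral on the semiaxis $(0,\infty)$ is $$ (IB_{\nu,-}^{\alpha}f)(x)=\frac{1}{\Gamma(2\alpha)}\int_x^{+\infty}\left(\frac{y^2-x^2}{2y}\right)^{2\alpha-1}{}_2F_1\left(\alpha+\frac{\nu-1}{2},\alpha;2\alpha;1-\frac{x^2}{y^2}\right)f(y)\,dy, $$ where ${}_2F_1$ is the Gauss hypergeometric function and $\Gamma$ is the gamma function. The fractional Bessel derivative on the semiaxis is defined by $$ (DB_{\nu,-}^{\alpha}f)(x)=B_\nu^n\,(IB_{\nu,-}^{n-\alpha}f)(x),\qquad \alpha>0, $$ where $B_\nu^n$ is the $n$-th power (iterate) of $B_\nu$ and $IB_{\nu,-}^{n-\alpha}$ is the fractional Bessel integral above with $n-\alpha$ in place of $\alpha$. The Mellin transform of a function $f$ is $f^*(s)=\int_0^\infty x^{s-1}f(x)\,dx$. *)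

theory Defs
  imports "HOL-Analysis.Analysis"
begin

text \<open>
  Functions on the semiaxis are rendered as functions \<open>real \<Rightarrow> complex\<close> of which only the
  values on \<open>{0<..}\<close> matter; real-valued functions embed via \<open>of_real\<close>.
\<close>

definition hyp_2F1 :: "real \<Rightarrow> real \<Rightarrow> real \<Rightarrow> real \<Rightarrow> real" where
  "hyp_2F1 a b c z = eval_fps (fps_hypergeo [a, b] [c] 1) z"

definition vderiv :: "(real \<Rightarrow> complex) \<Rightarrow> real \<Rightarrow> complex" where
  "vderiv f x = vector_derivative f (at x)"

definition smooth_on_semiaxis :: "(real \<Rightarrow> complex) \<Rightarrow> bool" where
  "smooth_on_semiaxis f \<longleftrightarrow> (\<forall>k. \<forall>x>0. ((vderiv ^^ k) f) differentiable (at x))"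

definition bessel_op :: "real \<Rightarrow> (real \<Rightarrow> complex) \<Rightarrow> real \<Rightarrow> complex" where
  "bessel_op \<nu> f x = vderiv (vderiv f) x + of_real (\<nu> / x) * vderiv f x"

text \<open>
  For \<open>y > x > 0\<close> the argument \<open>1 - x\<^sup>2 / y\<^sup>2\<close> lies in \<open>{0<..<1}\<close>, inside the disc of convergence
  of the hypergeometric series.
\<close>

definition bessel_integral :: "real \<Rightarrow> real \<Rightarrow> (real \<Rightarrow> complex) \<Rightarrow> real \<Rightarrow> complex" where
  "bessel_integral \<nu> \<alpha> f x =
     of_real (1 / Gamma (2 * \<alpha>)) *
     (LBINT y:{x<..}.
        of_real (((y\<^sup>2 - x\<^sup>2) / (2 * y)) powr (2 * \<alpha> - 1) *
                 hyp_2F1 (\<alpha> + (\<nu> - 1) / 2) \<alpha> (2 * \<alpha>) (1 - x\<^sup>2 / y\<^sup>2)) * f y)"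

text \<open>The order \<open>real n - \<alpha>\<close> of the inner integral has to be positive.\<close>

definition bessel_derivative ::
    "nat \<Rightarrow> real \<Rightarrow> real \<Rightarrow> (real \<Rightarrow> complex) \<Rightarrow> real \<Rightarrow> complex" where
  "bessel_derivative n \<nu> \<alpha> f = (bessel_op \<nu> ^^ n) (bessel_integral \<nu> (real n - \<alpha>) f)"

definition mellin_converges :: "(real \<Rightarrow> complex) \<Rightarrow> complex \<Rightarrow> bool" where
  "mellin_converges f s \<longleftrightarrow>
     set_integrable lborel {0<..} (\<lambda>x. of_real x powr (s - 1) * f x)"

definition mellin :: "(real \<Rightarrow> complex) \<Rightarrow> complex \<Rightarrow> complex" where
  "mellin f s = (LBINT x:{0<..}. of_real x powr (s - 1) * f x)"

text \<open>
  The library sets \<open>Gamma z = 0\<close> at the poles and \<open>x / 0 = 0\<close>, so a quotient whose denominator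
  contains \<open>Gamma z\<close> vanishes at a pole of that factor, in accordance with the entire function
  \<open>1 / \<Gamma>\<close>. Poles of a numerator factor carry no such meaning and have to be excluded.
\<close>

end

theory Submission
  imports Defs "HOL-Complex_Analysis.Complex_Analysis"
begin

text \<open>
  On \<open>(0, \<infinity>)\<close> the fractional Bessel integral is \<open>x\<^sup>2\<^sup>\<beta> \<integral> \<kappa>(u) f(x u) du\<close> over \<open>u > 1\<close>, so by Fubini its
  Mellin transform is that of \<open>f\<close>, shifted by \<open>2\<beta>\<close>, times a moment of \<open>\<kappa>\<close>. The substitution
  \<open>z = 1 - 1 / u\<^sup>2\<close> and termwise integration turn this moment into a Gauss sum, which is evaluated
  by expanding Beta functions under the binomial series. This is done for real \<open>s > max 0 (\<nu> - 1)\<close> only; all other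
  \<open>s\<close> at which the Mellin integral converges are reached by analytic continuation, with one-sided
  continuity at the edge of the half-plane of convergence.

  For the derivative, the Bessel operator \<open>B\<close> commutes with the fractional integral on smooth
  functions supported in \<open>[a, b]\<close>. Rather than differentiating the singular kernel, one inverts \<open>B\<close>
  explicitly by two tail integrals, checks that both sides have the same Mellin transform at all
  large real \<open>s\<close>, and concludes by the Weierstrass theorem on vanishing moments. Hence the fractional
  derivative of \<open>f\<close> is the fractional integral of order \<open>n - \<alpha>\<close> of \<open>B\<^sup>n f\<close>.
\<close>

subsection \<open>The Gauss sum as a Beta integral\<close>

text \<open>The moment of the kernel is the integral of z^(c-1) (1-z)^(r-1) 2F1(a,b;c;z) with a =
  \<beta> + (\<nu>-1)/2, b = \<beta>, c = 2\<beta>, r = s/2, that is, Beta(c,r) 2F1(a,b;c+r;1).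
  Gauss's condition c+r-a-b > 0 reads s > \<nu>-1, and r > 0 reads s > 0: hence the abscissa max 0
  (\<nu>-1). For \<nu> < 1 the parameter a can be negative, so the series need not have terms of one
  sign. The continuation is carried out for an identity with reciprocal Gamma factors. These are
  entire, so poles of the numerator matter only at the end, when the identity is solved for the
  Mellin transform. The inversion of B rests on B = x^(-\<nu>) D x^\<nu> D. On the Mellin side B is
  a shift by 2 with the factor s (s+1-\<nu>), and commutation reduces to \<Gamma>(z+1) = z
  \<Gamma>(z). In B^n the factors become rising factorials that turn 1/\<Gamma>(z+n) into
  1/\<Gamma>(z): n cancels, and the order n-\<alpha> yields the formula with -\<alpha> in place of
  \<alpha>.\<close>

lemma Beta_integral_Ioo:
  fixes p q :: real
  assumes "p > 0" "q > 0"
  shows "set_integrable lborel {0<..<1} (\<lambda>t. t powr (p - 1) * (1 - t) powr (q - 1))"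
    and "(LBINT t:{0<..<1}. t powr (p - 1) * (1 - t) powr (q - 1)) = Beta p q"
proof -
  show int: "set_integrable lborel {0<..<1} (\<lambda>t. t powr (p - 1) * (1 - t) powr (q - 1))"
    by (rule set_integrable_subset[OF integrable_Beta[OF assms]]) auto
  have "(LBINT t:{0<..<1}. t powr (p - 1) * (1 - t) powr (q - 1))
      = integral {0<..<1} (\<lambda>t. t powr (p - 1) * (1 - t) powr (q - 1))"
    using set_borel_integral_eq_integral(2)[OF int] .
  also have "\<dots> = Beta p q"
    using has_integral_Beta_real[OF assms] integral_unique has_integral_Icc_iff_Ioo by blast
  finally show "(LBINT t:{0<..<1}. t powr (p - 1) * (1 - t) powr (q - 1)) = Beta p q" .
qed

lemma Beta_integral_power_Ioo:
  fixes p q :: real and k :: nat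
  assumes "p > 0" "q > 0"
  shows "set_integrable lborel {0<..<1} (\<lambda>t. t powr (p - 1) * (1 - t) powr (q - 1) * t ^ k)"
    and "(LBINT t:{0<..<1}. t powr (p - 1) * (1 - t) powr (q - 1) * t ^ k) = Beta (p + real k) q"
proof -
  have eq: "t powr (p - 1) * (1 - t) powr (q - 1) * t ^ k
      = t powr (p + real k - 1) * (1 - t) powr (q - 1)" if "t \<in> {0<..<1}" for t
    using that by (simp add: powr_diff powr_add powr_realpow)
  show "set_integrable lborel {0<..<1} (\<lambda>t. t powr (p - 1) * (1 - t) powr (q - 1) * t ^ k)"
    using Beta_integral_Ioo(1)[of "p + real k" q] assms eq by (subst set_integrable_cong) auto
  show "(LBINT t:{0<..<1}. t powr (p - 1) * (1 - t) powr (q - 1) * t ^ k) = Beta (p + real k) q"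
    using Beta_integral_Ioo(2)[of "p + real k" q] assms eq
    by (subst set_lebesgue_integral_cong[OF _ allI[OF impI[OF eq]]]) auto
qed

lemma Beta_pos:
  fixes p q :: real
  assumes "p > 0" "q > 0"
  shows "Beta p q > 0"
  using assms by (simp add: Beta_def)

text \<open>The weight is nonnegative, so the k-th term has L1 norm |A k|
  \<open>Beta (p + real k) q\<close>, and \<open>sm\<close> is exactly the summability of these
  norms that permits termwise integration.\<close>

lemma Beta_integral_power_series:
  fixes p q :: real and A :: "nat \<Rightarrow> real"
  assumes p: "p > 0" and q: "q > 0"
    and ser: "\<And>t. t \<in> {0<..<1} \<Longrightarrow> summable (\<lambda>k. \<bar>A k\<bar> * t ^ k)"
    and sm: "summable (\<lambda>k. \<bar>A k\<bar> * Beta (p + real k) q)"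
  shows "set_integrable lborel {0<..<1} (\<lambda>t. t powr (p - 1) * (1 - t) powr (q - 1) * (\<Sum>k. A k * t ^ k))"
    and "(LBINT t:{0<..<1}. t powr (p - 1) * (1 - t) powr (q - 1) * (\<Sum>k. A k * t ^ k))
        = (\<Sum>k. A k * Beta (p + real k) q)"
proof -
  define w where "w k t = indicator {0<..<1} t *\<^sub>R (t powr (p - 1) * (1 - t) powr (q - 1) * t ^ k)"
    for k :: nat and t :: real
  have w_int: "integrable lborel (w k)" and w_val: "integral\<^sup>L lborel (w k) = Beta (p + real k) q" for k
    using Beta_integral_power_Ioo[OF p q, of k]
    unfolding w_def set_integrable_def set_lebesgue_integral_def by auto
  have w_nonneg: "w k t \<ge> 0" for k t unfolding w_def by (auto simp: indicator_def)
  have nrm: "norm (A k * w k t) = \<bar>A k\<bar> * w k t" for k t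
    using w_nonneg[of k t] by (simp add: abs_mult)
  have w_eq: "w k t = (indicator {0<..<1} t * (t powr (p - 1) * (1 - t) powr (q - 1))) * t ^ k" for k t
    by (simp add: w_def)
  have AEs: "summable (\<lambda>k. norm (A k * w k t))" for t
  proof (cases "t \<in> {0<..<1}")
    case True
    have "summable (\<lambda>k. (t powr (p - 1) * (1 - t) powr (q - 1)) * (\<bar>A k\<bar> * t ^ k))"
      by (intro summable_mult ser True)
    thus ?thesis unfolding nrm unfolding w_eq using True by (simp add: mult.left_commute mult.assoc)
  next
    case False thus ?thesis unfolding w_def by simp
  qed
  have sm': "summable (\<lambda>k. \<integral>t. norm (A k * w k t) \<partial>lborel)"
    unfolding nrm using sm w_val by simp
  have Aw_int: "integrable lborel (\<lambda>t. A k * w k t)" for k using w_int by simp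
  have sum_eq: "(\<Sum>k. A k * w k t) = indicator {0<..<1} t *\<^sub>R
      (t powr (p - 1) * (1 - t) powr (q - 1) * (\<Sum>k. A k * t ^ k))" for t
  proof (cases "t \<in> {0<..<1}")
    case True
    have "summable (\<lambda>k. A k * t ^ k)"
      using ser[OF True] True by (intro summable_norm_cancel[of "\<lambda>k. A k * t ^ k"]) (simp add: abs_mult)
    hence "(\<Sum>k. (t powr (p - 1) * (1 - t) powr (q - 1)) * (A k * t ^ k))
        = (t powr (p - 1) * (1 - t) powr (q - 1)) * (\<Sum>k. A k * t ^ k)"
      by (rule suminf_mult)
    thus ?thesis using True by (simp add: w_def mult_ac)
  next
    case False thus ?thesis unfolding w_def by simp
  qed
  show "set_integrable lborel {0<..<1} (\<lambda>t. t powr (p - 1) * (1 - t) powr (q - 1) * (\<Sum>k. A k * t ^ k))"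
    using integrable_suminf[OF Aw_int AE_I2[OF AEs] sm'] unfolding set_integrable_def sum_eq .
  show "(LBINT t:{0<..<1}. t powr (p - 1) * (1 - t) powr (q - 1) * (\<Sum>k. A k * t ^ k))
        = (\<Sum>k. A k * Beta (p + real k) q)"
    using integral_suminf[OF Aw_int AE_I2[OF AEs] sm'] w_val
    unfolding set_lebesgue_integral_def sum_eq by simp
qed

lemma binomial_pochhammer_sums:
  fixes a t :: real
  assumes "\<bar>t\<bar> < 1"
  shows "(\<lambda>k. pochhammer a k / fact k * t ^ k) sums ((1 - t) powr (- a))"
proof -
  have "(\<lambda>k. ((- a) gchoose k) * (- t) ^ k) sums (1 + (- t)) powr (- a)"
    using assms by (intro gen_binomial_real) auto
  moreover have "((- a) gchoose k) * (- t) ^ k = pochhammer a k / fact k * t ^ k" for k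
  proof -
    have "(-1) ^ k * (- t) ^ k = t ^ k" by (simp flip: power_mult_distrib)
    thus ?thesis by (simp add: gbinomial_pochhammer)
  qed
  ultimately show ?thesis by simp
qed

text \<open>For \<open>a > -1\<close> all coefficients except possibly the constant one have the same sign, so the
  series of absolute values is again essentially a binomial series.\<close>

lemma binomial_pochhammer_abs:
  fixes a t :: real
  assumes a: "a > -1" and t: "0 < t" "t < 1"
  shows "summable (\<lambda>k. \<bar>pochhammer a k / fact k\<bar> * t ^ k)"
    and "(\<Sum>k. \<bar>pochhammer a k / fact k\<bar> * t ^ k) \<le> 2 * (1 - t) powr (- max a 0)"
proof -
  have B: "(\<lambda>k. pochhammer a k / fact k * t ^ k) sums ((1 - t) powr (- a))"
    using t by (intro binomial_pochhammer_sums) auto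
  \<comment> \<open>For -1 < a < 0 all terms but the constant 1 change sign, so a sum T becomes 1 -
    (T - 1) = 2 - T.\<close>
  define S where "S = (if a \<ge> 0 then (1 - t) powr (- a) else 2 - (1 - t) powr (- a))"
  have S: "(\<lambda>k. \<bar>pochhammer a k / fact k\<bar> * t ^ k) sums S"
  proof (cases "a \<ge> 0")
    case True
    have nn: "pochhammer a k \<ge> 0" for k
      unfolding pochhammer_prod using True by (intro prod_nonneg) simp
    have abs_eq: "\<bar>pochhammer a k / fact k\<bar> = pochhammer a k / fact k" for k
      using nn[of k] by (intro abs_of_nonneg divide_nonneg_pos) simp_all
    have S_eq: "S = (1 - t) powr (- a)" unfolding S_def using True by (rule if_P)
    show ?thesis unfolding abs_eq S_eq by (rule B)
  next
    case False
    have neg: "pochhammer a k \<le> 0" if k: "k \<noteq> 0" for k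
    proof -
      obtain m where m: "k = Suc m" using not0_implies_Suc[OF k] by blast
      have "pochhammer (a + 1) m \<ge> 0"
        unfolding pochhammer_prod using a by (intro prod_nonneg) simp
      thus ?thesis using False by (simp add: m pochhammer_rec mult_nonpos_nonneg)
    qed
    have eq: "\<bar>pochhammer a k / fact k\<bar> * t ^ k
        = (if k = 0 then 2 else 0) - pochhammer a k / fact k * t ^ k" for k
    proof (cases "k = 0")
      case False
      have "\<bar>pochhammer a k / fact k\<bar> = - (pochhammer a k / fact k)"
        using neg[OF False] by (intro abs_of_nonpos divide_nonpos_pos) auto
      thus ?thesis using False by simp
    qed simp
    have "(\<lambda>k. if k = 0 then 2 else 0 :: real) sums 2"
      using sums_If_finite_set[of "{0}" "\<lambda>_. 2::real"] by simp
    from sums_diff[OF this B] show ?thesis unfolding eq S_def using False by (simp only: if_False)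
  qed
  show "summable (\<lambda>k. \<bar>pochhammer a k / fact k\<bar> * t ^ k)" using S by (rule sums_summable)
  have "S \<le> 2 * (1 - t) powr (- max a 0)"
  proof (cases "a \<ge> 0")
    case True
    thus ?thesis by (simp add: S_def max_def)
  next
    case False
    thus ?thesis using t by (simp add: S_def max_def)
  qed
  thus "(\<Sum>k. \<bar>pochhammer a k / fact k\<bar> * t ^ k) \<le> 2 * (1 - t) powr (- max a 0)"
    using sums_unique[OF S] by simp
qed

text \<open>Expand the factor (1-t)^(-a) in the integral for \<open>Beta b (q - a)\<close>. Divided
  by \<open>Beta b q\<close>, the result is Gauss's value of 2F1(a,b;b+q;1). The condition on
  \<open>q\<close> makes both \<open>q\<close> and \<open>q - a\<close> positive.\<close>

lemma binomial_Beta_sum: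
  fixes a b q :: real
  assumes a: "a > -1" and b: "b > 0" and q: "q > max a 0"
  shows "summable (\<lambda>k. \<bar>pochhammer a k / fact k\<bar> * Beta (b + real k) q)"
    and "(\<Sum>k. pochhammer a k / fact k * Beta (b + real k) q) = Beta b (q - a)"
proof -
  define A where "A k = pochhammer a k / fact k" for k
  have ser: "summable (\<lambda>k. \<bar>A k\<bar> * t ^ k)" if "t \<in> {0<..<1}" for t
    using binomial_pochhammer_abs(1)[OF a, of t] that by (simp add: A_def)
  have q0: "q > 0" using q by simp
  \<comment> \<open>Termwise integration presupposes the summability to be shown. Finite partial
    sums commute with the integral in any case, and the bound on the absolute binomial series gives
    them a common bound.\<close>
  have bnd: "(\<Sum>k<N. \<bar>A k\<bar> * Beta (b + real k) q) \<le> 2 * Beta b (q - max a 0)" for N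
  proof -
    have int: "set_integrable lborel {0<..<1} (\<lambda>t. t powr (b - 1) * (1 - t) powr (q - 1) * t ^ k)" for k
      by (rule Beta_integral_power_Ioo(1)[OF b q0])
    have "(\<Sum>k<N. \<bar>A k\<bar> * Beta (b + real k) q)
        = (\<Sum>k<N. LBINT t:{0<..<1}. \<bar>A k\<bar> * (t powr (b - 1) * (1 - t) powr (q - 1) * t ^ k))"
      using Beta_integral_power_Ioo(2)[OF b q0] by simp
    also have "\<dots> = (LBINT t:{0<..<1}. \<Sum>k<N. \<bar>A k\<bar> * (t powr (b - 1) * (1 - t) powr (q - 1) * t ^ k))"
      using int unfolding set_lebesgue_integral_def set_integrable_def scaleR_sum_right
      by (subst Bochner_Integration.integral_sum) (auto simp: mult.left_commute)
    also have "\<dots> \<le> (LBINT t:{0<..<1}. 2 * (t powr (b - 1) * (1 - t) powr (q - max a 0 - 1)))"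
    proof (rule set_integral_mono)
      show "set_integrable lborel {0<..<1} (\<lambda>t. \<Sum>k<N. \<bar>A k\<bar> * (t powr (b - 1) * (1 - t) powr (q - 1) * t ^ k))"
        using int unfolding set_integrable_def scaleR_sum_right
        by (intro Bochner_Integration.integrable_sum) (auto simp: mult.left_commute)
      show "set_integrable lborel {0<..<1} (\<lambda>t. 2 * (t powr (b - 1) * (1 - t) powr (q - max a 0 - 1)))"
        using Beta_integral_Ioo(1)[OF b, of "q - max a 0"] q by auto
      fix t :: real assume t: "t \<in> {0<..<1}"
      have "(\<Sum>k<N. \<bar>A k\<bar> * (t powr (b - 1) * (1 - t) powr (q - 1) * t ^ k))
          = (t powr (b - 1) * (1 - t) powr (q - 1)) * (\<Sum>k<N. \<bar>A k\<bar> * t ^ k)"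
        by (simp add: sum_distrib_left mult_ac)
      also have "(\<Sum>k<N. \<bar>A k\<bar> * t ^ k) \<le> (\<Sum>k. \<bar>A k\<bar> * t ^ k)"
        using ser[OF t] t by (intro sum_le_suminf) auto
      also have "\<dots> \<le> 2 * (1 - t) powr (- max a 0)"
        using binomial_pochhammer_abs(2)[OF a, of t] t by (simp add: A_def)
      also have "(t powr (b - 1) * (1 - t) powr (q - 1)) * (2 * (1 - t) powr (- max a 0))
          = 2 * (t powr (b - 1) * (1 - t) powr (q - max a 0 - 1))"
        by (simp add: algebra_simps flip: powr_add)
      finally show "(\<Sum>k<N. \<bar>A k\<bar> * (t powr (b - 1) * (1 - t) powr (q - 1) * t ^ k))
          \<le> 2 * (t powr (b - 1) * (1 - t) powr (q - max a 0 - 1))"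
        using t by (simp add: mult_left_mono)
    qed
    also have "\<dots> = 2 * Beta b (q - max a 0)"
      using Beta_integral_Ioo(2)[OF b, of "q - max a 0"] q by simp
    finally show ?thesis .
  qed
  have nn: "\<bar>A k\<bar> * Beta (b + real k) q \<ge> 0" for k
    using Beta_pos[of "b + real k" q] b q0 by simp
  show sm: "summable (\<lambda>k. \<bar>pochhammer a k / fact k\<bar> * Beta (b + real k) q)"
    using summableI_nonneg_bounded[OF nn bnd] by (simp add: A_def)
  have "(\<Sum>k. A k * Beta (b + real k) q)
      = (LBINT t:{0<..<1}. t powr (b - 1) * (1 - t) powr (q - 1) * (\<Sum>k. A k * t ^ k))"
    using Beta_integral_power_series(2)[OF b q0 ser] sm by (simp add: A_def)
  also have "\<dots> = (LBINT t:{0<..<1}. t powr (b - 1) * (1 - t) powr (q - a - 1))"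
  proof (rule set_lebesgue_integral_cong)
    show "\<forall>t. t \<in> {0<..<1} \<longrightarrow> t powr (b - 1) * (1 - t) powr (q - 1) * (\<Sum>k. A k * t ^ k)
        = t powr (b - 1) * (1 - t) powr (q - a - 1)"
    proof safe
      fix t :: real assume t: "t \<in> {0<..<1}"
      hence "(\<Sum>k. A k * t ^ k) = (1 - t) powr (- a)"
        using binomial_pochhammer_sums[of t a] by (auto simp: A_def sums_iff)
      thus "t powr (b - 1) * (1 - t) powr (q - 1) * (\<Sum>k. A k * t ^ k)
        = t powr (b - 1) * (1 - t) powr (q - a - 1)"
        by (simp add: algebra_simps flip: powr_add)
    qed
  qed auto
  also have "\<dots> = Beta b (q - a)"
    using q by (intro Beta_integral_Ioo(2) b) auto
  finally show "(\<Sum>k. pochhammer a k / fact k * Beta (b + real k) q) = Beta b (q - a)"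
    by (simp add: A_def)
qed

lemma hyp_2F1_eq_suminf:
  "hyp_2F1 a b c z = (\<Sum>k. pochhammer a k * pochhammer b k / (pochhammer c k * fact k) * z ^ k)"
  by (simp add: hyp_2F1_def eval_fps_def)

text \<open>Integrating z^k against the weight produces \<open>Beta (c + real k) r\<close>, which
  absorbs the rising factorial of \<open>c\<close> and leaves a multiple of the series of
  \<open>binomial_Beta_sum\<close> with q = c + r - b. The condition b \<le> c keeps the
  coefficients below those of the binomial series.\<close>

lemma hyp_2F1_Beta_integral:
  fixes a b c r :: real
  assumes a: "a > -1" and b: "b > 0" "b \<le> c" and r: "r > 0" and cr: "c + r - b > max a 0"
  shows "set_integrable lborel {0<..<1} (\<lambda>z. z powr (c - 1) * (1 - z) powr (r - 1) * hyp_2F1 a b c z)"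
    and "(LBINT z:{0<..<1}. z powr (c - 1) * (1 - z) powr (r - 1) * hyp_2F1 a b c z)
        = Gamma c * Gamma r * Gamma (c + r - a - b) / (Gamma (c + r - b) * Gamma (c + r - a))"
proof -
  define A where "A k = pochhammer a k * pochhammer b k / (pochhammer c k * fact k)" for k
  define K where "K = Gamma c * Gamma r / (Gamma b * Gamma (c + r - b))"
  have c: "c > 0" using b by simp
  have K: "K > 0" unfolding K_def using b c r cr by simp
  have le: "\<bar>A k\<bar> \<le> \<bar>pochhammer a k / fact k\<bar>" for k
  proof -
    have "0 \<le> pochhammer b k" "pochhammer b k \<le> pochhammer c k"
      using b by (auto simp: pochhammer_prod intro!: prod_mono prod_nonneg)
    moreover have "pochhammer c k > 0" by (rule pochhammer_pos[OF c])
    ultimately have "\<bar>pochhammer b k / pochhammer c k\<bar> \<le> 1" by (simp add: field_simps)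
    hence "\<bar>pochhammer a k / fact k\<bar> * \<bar>pochhammer b k / pochhammer c k\<bar> \<le> \<bar>pochhammer a k / fact k\<bar>"
      by (intro mult_left_le) auto
    thus ?thesis by (simp add: A_def abs_mult mult_ac)
  qed
  have ser: "summable (\<lambda>k. \<bar>A k\<bar> * t ^ k)" if t: "t \<in> {0<..<1}" for t
  proof (rule summable_comparison_test'[where N = 0])
    show "summable (\<lambda>k. \<bar>pochhammer a k / fact k\<bar> * t ^ k)"
      using binomial_pochhammer_abs(1)[OF a, of t] t by simp
    show "norm (\<bar>A k\<bar> * t ^ k) \<le> \<bar>pochhammer a k / fact k\<bar> * t ^ k" for k
      using mult_right_mono[OF le[of k], of "t ^ k"] t by (simp add: abs_mult)
  qed
  \<comment> \<open>Both sides are \<Gamma>(c) \<Gamma>(r) \<Gamma>(b+k) / (\<Gamma>(b)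
    \<Gamma>(c+r+k)); the factor \<Gamma>(c+r-b) in \<open>K\<close> only serves to complete a Beta
    function.\<close>
  have term_eq: "pochhammer b k / pochhammer c k * Beta (c + real k) r = K * Beta (b + real k) (c + r - b)" for k
  proof -
    have alg: "(x / y) / (z / w) * (z * v / u) = w * v / (y * t) * (x * t / u)"
      if "y > 0" "z > 0" "w > 0" "t > 0" for x y z w v u t :: real
      using that by (simp add: field_simps)
    have "Gamma c > 0" "Gamma b > 0" "Gamma (c + real k) > 0" "Gamma (c + r - b) > 0"
      using b c cr by auto
    moreover have "b \<notin> \<int>\<^sub>\<le>\<^sub>0" "c \<notin> \<int>\<^sub>\<le>\<^sub>0" using b c by (auto elim!: nonpos_Ints_cases)
    moreover have eq: "b + real k + (c + r - b) = c + real k + r" by simp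
    ultimately show ?thesis
      unfolding K_def Beta_def eq
      using alg[of "Gamma b" "Gamma (c + real k)" "Gamma c" "Gamma (c + r - b)" "Gamma (b + real k)"
          "Gamma r" "Gamma (c + real k + r)"]
      by (simp only: pochhammer_Gamma not_False_eq_True)
  qed
  have A_eq: "A k * Beta (c + real k) r = K * (pochhammer a k / fact k * Beta (b + real k) (c + r - b))" for k
  proof -
    have "A k * Beta (c + real k) r = pochhammer a k / fact k * (pochhammer b k / pochhammer c k * Beta (c + real k) r)"
      by (simp add: A_def mult_ac)
    thus ?thesis unfolding term_eq by (simp add: mult_ac)
  qed
  have abs_eq: "\<bar>A k\<bar> * Beta (c + real k) r = K * (\<bar>pochhammer a k / fact k\<bar> * Beta (b + real k) (c + r - b))" for k
  proof -
    have "Beta (c + real k) r > 0" "Beta (b + real k) (c + r - b) > 0"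
      using b c r cr by (auto intro!: Beta_pos)
    thus ?thesis using arg_cong[OF A_eq[of k], of abs] K by (simp add: abs_mult)
  qed
  have sm: "summable (\<lambda>k. \<bar>A k\<bar> * Beta (c + real k) r)"
    unfolding abs_eq by (intro summable_mult binomial_Beta_sum(1) a b cr)
  have F: "hyp_2F1 a b c z = (\<Sum>k. A k * z ^ k)" for z
    by (simp add: hyp_2F1_eq_suminf A_def)
  show "set_integrable lborel {0<..<1} (\<lambda>z. z powr (c - 1) * (1 - z) powr (r - 1) * hyp_2F1 a b c z)"
    unfolding F by (rule Beta_integral_power_series(1)[OF c r ser sm])
  have sm2: "summable (\<lambda>k. pochhammer a k / fact k * Beta (b + real k) (c + r - b))"
    using binomial_Beta_sum(1)[OF a b(1) cr]
    by (intro summable_norm_cancel[of "\<lambda>k. pochhammer a k / fact k * Beta (b + real k) (c + r - b)"])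
       (use Beta_pos[of "b + real _" "c + r - b"] b cr in \<open>simp add: abs_mult less_imp_le\<close>)
  have "(LBINT z:{0<..<1}. z powr (c - 1) * (1 - z) powr (r - 1) * hyp_2F1 a b c z)
      = (\<Sum>k. K * (pochhammer a k / fact k * Beta (b + real k) (c + r - b)))"
    unfolding F A_eq[symmetric] by (rule Beta_integral_power_series(2)[OF c r ser sm])
  also have "\<dots> = K * Beta b (c + r - b - a)"
    using suminf_mult[OF sm2, of K] binomial_Beta_sum(2)[OF a b(1) cr] by simp
  also have "\<dots> = Gamma c * Gamma r * Gamma (c + r - a - b) / (Gamma (c + r - b) * Gamma (c + r - a))"
  proof -
    have "Gamma b > 0" using b by simp
    thus ?thesis by (simp add: K_def Beta_def algebra_simps)
  qed
  finally show "(LBINT z:{0<..<1}. z powr (c - 1) * (1 - z) powr (r - 1) * hyp_2F1 a b c z)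
        = Gamma c * Gamma r * Gamma (c + r - a - b) / (Gamma (c + r - b) * Gamma (c + r - a))" .
qed

subsection \<open>Mellin transforms of dilation convolutions\<close>

lemma of_real_powr_minus_1:
  "x > 0 \<Longrightarrow> complex_of_real x powr (of_real s - 1) = of_real (x powr (s - 1))"
  using powr_of_real[of x "s - 1"] by simp

lemma mellin_converges_cong:
  assumes "\<And>x. x > 0 \<Longrightarrow> f x = g x"
  shows "mellin_converges f s \<longleftrightarrow> mellin_converges g s"
  unfolding mellin_converges_def using assms by (intro set_integrable_cong) auto

lemma mellin_cong:
  assumes "\<And>x. x > 0 \<Longrightarrow> f x = g x"
  shows "mellin f s = mellin g s"
  unfolding mellin_def using assms by (intro set_lebesgue_integral_cong) auto

lemma powr_minus_1_mult_powr:
  "x > 0 \<Longrightarrow> complex_of_real x powr (s - 1) * (of_real (x powr p) * y) = of_real x powr (s + of_real p - 1) * y"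
  using powr_of_real[of x p] powr_add[of "complex_of_real x" "s - 1" "of_real p"]
  by (simp add: algebra_simps)

lemma mellin_converges_powr_mult:
  "mellin_converges (\<lambda>x. of_real (x powr p) * g x) s \<longleftrightarrow> mellin_converges g (s + of_real p)"
  unfolding mellin_converges_def
  by (intro set_integrable_cong) (auto simp: powr_minus_1_mult_powr)

lemma mellin_powr_mult:
  "mellin (\<lambda>x. of_real (x powr p) * g x) s = mellin g (s + of_real p)"
  unfolding mellin_def
  by (intro set_lebesgue_integral_cong) (auto simp: powr_minus_1_mult_powr)

text \<open>A convolution for the multiplicative group, written with dilations of \<open>g\<close>
  by u > 1; the Mellin transform turns it into a product.\<close>

definition dil_conv :: "(real \<Rightarrow> real) \<Rightarrow> (real \<Rightarrow> complex) \<Rightarrow> real \<Rightarrow> complex" where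
  "dil_conv \<kappa> g x = (LBINT u:{1<..}. of_real (\<kappa> u) * g (x * u))"

text \<open>The dilate x \<mapsto> g(xu) has the Mellin transform u^(-s) g*(s), so exchanging the
  integrals leaves the moment of \<open>\<kappa>\<close> of exponent -s. The two integrability
  assumptions are what Fubini requires.\<close>

lemma mellin_dil_conv:
  fixes s :: real
  assumes \<kappa>: "set_integrable lborel {1<..} (\<lambda>u. u powr (- s) * \<kappa> u)"
    and g: "mellin_converges g (of_real s)"
  shows "mellin_converges (dil_conv \<kappa> g) (of_real s)"
    and "mellin (dil_conv \<kappa> g) (of_real s)
        = of_real (LBINT u:{1<..}. u powr (- s) * \<kappa> u) * mellin g (of_real s)"
proof -
  define G where "G x = indicator {0<..} x *\<^sub>R (complex_of_real x powr (of_real s - 1) * g x)" for x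
  define K where "K u = indicator {1<..} u *\<^sub>R (u powr (- s) * \<kappa> u)" for u
  \<comment> \<open>The extra factor \<open>u\<close> plays two roles: it cancels the Jacobian of x
    \<mapsto> ux in the integral over x, and with u^(-s) and (ux)^(s-1) it leaves x^(s-1) in the
    integral over u. The summand 0 matches the affine substitution rule.\<close>
  define \<Phi> where "\<Phi> u x = complex_of_real (K u * u) * G (0 + u * x)" for u x
  have G: "integrable lborel G" using g unfolding mellin_converges_def set_integrable_def G_def .
  have K: "integrable lborel K" using \<kappa> unfolding set_integrable_def K_def .
  have [measurable]: "G \<in> borel_measurable borel" "K \<in> borel_measurable borel"
    using borel_measurable_integrable[OF G] borel_measurable_integrable[OF K] by auto
  have K0: "K u = 0" if "\<not> u > 1" for u using that by (simp add: K_def)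
  have \<Phi>_int: "integrable lborel (\<Phi> u)" for u
  proof (cases "u > 1")
    case True
    thus ?thesis unfolding \<Phi>_def using lborel_integrable_real_affine[OF G, of u 0] by auto
  next
    case False
    hence "\<Phi> u = (\<lambda>_. 0)" by (simp add: \<Phi>_def K0 fun_eq_iff)
    thus ?thesis by simp
  qed
  have \<Phi>_norm: "(\<integral>x. norm (\<Phi> u x) \<partial>lborel) = norm (K u) * (\<integral>x. norm (G x) \<partial>lborel)" for u
  proof (cases "u > 1")
    case True
    have "(\<integral>x. norm (G x) \<partial>lborel) = u * (\<integral>x. norm (G (0 + u * x)) \<partial>lborel)"
      using lborel_integral_real_affine[of u "\<lambda>x. norm (G x)" 0] True by simp
    thus ?thesis using True by (simp add: \<Phi>_def norm_mult abs_mult)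
  qed (simp add: \<Phi>_def K0)
  have \<Phi>_val: "(\<integral>x. \<Phi> u x \<partial>lborel) = of_real (K u) * (\<integral>x. G x \<partial>lborel)" for u
  proof (cases "u > 1")
    case True
    have "(\<integral>x. G x \<partial>lborel) = of_real u * (\<integral>x. G (0 + u * x) \<partial>lborel)"
      using lborel_integral_real_affine[of u G 0] True by (simp add: scaleR_conv_of_real)
    thus ?thesis using True by (simp add: \<Phi>_def)
  qed (simp add: \<Phi>_def K0)
  have pair: "integrable (lborel \<Otimes>\<^sub>M lborel) (case_prod \<Phi>)"
  proof (rule lborel_pair.Fubini_integrable)
    show "case_prod \<Phi> \<in> borel_measurable (lborel \<Otimes>\<^sub>M lborel)"
      unfolding \<Phi>_def by measurable
    show "integrable lborel (\<lambda>u. \<integral>x. norm (case_prod \<Phi> (u, x)) \<partial>lborel)"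
      using K by (simp add: \<Phi>_norm)
    show "AE u in lborel. integrable lborel (\<lambda>x. case_prod \<Phi> (u, x))"
      using \<Phi>_int by simp
  qed
  have inner: "(\<integral>u. \<Phi> u x \<partial>lborel)
      = indicator {0<..} x *\<^sub>R (complex_of_real x powr (of_real s - 1) * dil_conv \<kappa> g x)" for x
  proof (cases "x > 0")
    case True
    have "\<Phi> u x = of_real (x powr (s - 1)) * (indicator {1<..} u *\<^sub>R (of_real (\<kappa> u) * g (x * u)))" for u
    proof (cases "u > 1")
      case u: True
      have "complex_of_real (u * x) powr (of_real s - 1) = of_real (u powr (s - 1) * x powr (s - 1))"
        using u True by (subst of_real_powr_minus_1) (auto simp: powr_mult)
      moreover have "u powr (- s) * u * u powr (s - 1) = 1"
        using u powr_add[of u "- s" "s - 1"] by (simp add: powr_minus field_simps)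
      hence "complex_of_real (u powr (- s)) * of_real u * of_real (u powr (s - 1)) = 1"
        by (metis of_real_1 of_real_mult)
      ultimately show ?thesis using u True
        by (simp add: \<Phi>_def K_def G_def mult_ac)
    qed (simp add: \<Phi>_def K_def)
    hence "(\<lambda>u. \<Phi> u x) = (\<lambda>u. of_real (x powr (s - 1)) * (indicator {1<..} u *\<^sub>R (of_real (\<kappa> u) * g (x * u))))"
      by (rule ext)
    hence "(\<integral>u. \<Phi> u x \<partial>lborel) = of_real (x powr (s - 1)) * dil_conv \<kappa> g x"
      unfolding dil_conv_def set_lebesgue_integral_def by (simp only: integral_mult_right_zero)
    thus ?thesis using True by (simp add: of_real_powr_minus_1)
  next
    case False
    have "\<Phi> u x = 0" for u
    proof (cases "u > 1")
      case True
      hence "u * x \<le> 0" using False by (simp add: mult_nonneg_nonpos)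
      thus ?thesis by (simp add: \<Phi>_def G_def)
    qed (simp add: \<Phi>_def K_def)
    thus ?thesis using False by simp
  qed
  show "mellin_converges (dil_conv \<kappa> g) (of_real s)"
    unfolding mellin_converges_def set_integrable_def inner[symmetric]
    using lborel_pair.integrable_snd[OF pair] .
  have "mellin (dil_conv \<kappa> g) (of_real s) = (\<integral>x. (\<integral>u. \<Phi> u x \<partial>lborel) \<partial>lborel)"
    unfolding mellin_def set_lebesgue_integral_def inner ..
  also have "\<dots> = (\<integral>u. (\<integral>x. \<Phi> u x \<partial>lborel) \<partial>lborel)"
    by (rule lborel_pair.Fubini_integral[OF pair])
  also have "\<dots> = of_real (\<integral>u. K u \<partial>lborel) * (\<integral>x. G x \<partial>lborel)"
    unfolding \<Phi>_val by simp
  finally show "mellin (dil_conv \<kappa> g) (of_real s)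
        = of_real (LBINT u:{1<..}. u powr (- s) * \<kappa> u) * mellin g (of_real s)"
    unfolding mellin_def set_lebesgue_integral_def K_def G_def .
qed

section \<open>Tail integrals: Mellin transform and derivative\<close>

lemma set_integral_dilation:
  fixes \<psi> :: "real \<Rightarrow> complex"
  assumes "x > 0"
  shows "(LBINT y:{x<..}. \<psi> y) = of_real x * (LBINT u:{1<..}. \<psi> (x * u))"
proof -
  have "indicator {x<..} (0 + x * u) = (indicator {1<..} u :: real)" for u
    using assms by (auto simp: indicator_def)
  thus ?thesis unfolding set_lebesgue_integral_def
    using assms by (subst lborel_integral_real_affine[of x _ 0]) (auto simp: scaleR_conv_of_real)
qed

definition tail_integral :: "(real \<Rightarrow> complex) \<Rightarrow> real \<Rightarrow> complex" where
  "tail_integral \<psi> x = (LBINT y:{x<..}. \<psi> y)"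

text \<open>A tail integral is x times the dilation convolution with the constant kernel 1, whose
  moment is the integral of u^(-s-1) over u > 1, namely 1/s.\<close>

lemma mellin_tail_integral:
  fixes s :: real
  assumes s: "s > 0" and \<psi>: "mellin_converges \<psi> (of_real (s + 1))"
  shows "mellin_converges (tail_integral \<psi>) (of_real s)"
    and "mellin (tail_integral \<psi>) (of_real s) = mellin \<psi> (of_real (s + 1)) / of_real s"
proof -
  have HI: "((\<lambda>u. u powr (- (s + 1))) has_integral (- (1 powr (- (s + 1) + 1)) / (- (s + 1) + 1))) {1..}"
    using s by (intro has_integral_powr_to_inf) auto
  have AI: "(\<lambda>u::real. u powr (- (s + 1))) absolutely_integrable_on {1..}"
    using HI by (intro nonnegative_absolutely_integrable_1) auto
  have int: "set_integrable lborel {1<..} (\<lambda>u. u powr (- (s + 1)) * 1)"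
    by (rule set_integrable_subset[of _ "{1..}"])
       (use AI in \<open>auto simp: set_integrable_def integrable_completion\<close>)
  have "(LBINT u:{1<..}. u powr (- (s + 1)) * 1) = integral {1<..} (\<lambda>u. u powr (- (s + 1)) * 1)"
    by (rule set_borel_integral_eq_integral[OF int])
  also have "\<dots> = integral {1..} (\<lambda>u. u powr (- (s + 1)) * 1)"
    by (rule integral_spike_set) (rule negligible_subset[of "{1}"]; auto)+
  also have "\<dots> = 1 / s" using HI by (simp add: integral_unique)
  finally have val: "(LBINT u:{1<..}. u powr (- (s + 1)) * 1) = 1 / s" .
  have eq: "tail_integral \<psi> x = of_real (x powr 1) * dil_conv (\<lambda>_. 1) \<psi> x" if "x > 0" for x
    using set_integral_dilation[OF that, of \<psi>] that by (simp add: tail_integral_def dil_conv_def)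
  show "mellin_converges (tail_integral \<psi>) (of_real s)"
    using mellin_dil_conv(1)[OF int \<psi>] mellin_converges_powr_mult[of 1 _ "of_real s"]
    by (subst mellin_converges_cong[OF eq]) auto
  have "mellin (tail_integral \<psi>) (of_real s) = mellin (dil_conv (\<lambda>_. 1) \<psi>) (of_real (s + 1))"
    using mellin_powr_mult[of 1 _ "of_real s"] by (subst mellin_cong[OF eq]) auto
  thus "mellin (tail_integral \<psi>) (of_real s) = mellin \<psi> (of_real (s + 1)) / of_real s"
    unfolding mellin_dil_conv(2)[OF int \<psi>] val by simp
qed

lemma tail_integral_eq_integral:
  assumes cont: "continuous_on {0<..} \<psi>" and zero: "\<And>x. x \<ge> b \<Longrightarrow> \<psi> x = 0"
    and x: "0 < x" "x \<le> B" "b \<le> B"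
  shows "tail_integral \<psi> x = integral {x..B} \<psi>"
proof -
  have "continuous_on {x..B} \<psi>" by (rule continuous_on_subset[OF cont]) (use x in auto)
  hence int: "set_integrable lborel {x..B} \<psi>" by (rule borel_integrable_atLeastAtMost')
  have "tail_integral \<psi> x = (LBINT y:{x..B}. \<psi> y)"
    unfolding tail_integral_def set_lebesgue_integral_def
    by (rule integral_discrete_difference[of "{x}"]) (use zero x in \<open>auto simp: indicator_def\<close>)
  also have "\<dots> = integral {x..B} \<psi>" by (rule set_borel_integral_eq_integral(2)[OF int])
  finally show ?thesis .
qed

lemma tail_integral_zero:
  assumes "\<And>x. x \<ge> b \<Longrightarrow> \<psi> x = 0" "x \<ge> b"
  shows "tail_integral \<psi> x = 0"
proof -
  have "indicator {x<..} y *\<^sub>R \<psi> y = 0" for y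
    using assms by (auto simp: indicator_def)
  thus ?thesis unfolding tail_integral_def set_lebesgue_integral_def by (simp only: integral_zero)
qed

lemma has_vector_derivative_tail_integral:
  assumes cont: "continuous_on {0<..} \<psi>" and zero: "\<And>x. x \<ge> b \<Longrightarrow> \<psi> x = 0"
    and x: "0 < x"
  shows "(tail_integral \<psi> has_vector_derivative - \<psi> x) (at x)"
proof -
  \<comment> \<open>\<open>x\<close> is interior to [x/2, B], which gives a two-sided derivative,
    and \<psi> vanishes beyond \<open>B\<close>, so the tail is a difference of integrals from the
    fixed anchor x/2.\<close>
  define B where "B = max b x + 1"
  have B: "b \<le> B" "x < B" by (auto simp: B_def)
  have c: "continuous_on {x/2..B} \<psi>" by (rule continuous_on_subset[OF cont]) (use x in auto)
  have "((\<lambda>y. integral {x/2..y} \<psi>) has_vector_derivative \<psi> x) (at x within {x/2..B})"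
    using x B by (intro integral_has_vector_derivative[OF c]) auto
  hence "((\<lambda>y. integral {x/2..y} \<psi>) has_vector_derivative \<psi> x) (at x)"
    using x B by (subst (asm) at_within_interior) auto
  hence D: "((\<lambda>y. integral {x/2..B} \<psi> - integral {x/2..y} \<psi>) has_vector_derivative (0 - \<psi> x)) (at x)"
    by (intro has_vector_derivative_diff) auto
  have "integral {x/2..B} \<psi> - integral {x/2..y} \<psi> = tail_integral \<psi> y" if y: "y \<in> {x/2<..<B}" for y
  proof -
    have "integral {x/2..y} \<psi> + integral {y..B} \<psi> = integral {x/2..B} \<psi>"
      using y by (intro Henstock_Kurzweil_Integration.integral_combine integrable_continuous_real c) auto
    moreover have "tail_integral \<psi> y = integral {y..B} \<psi>"
      using y x B by (intro tail_integral_eq_integral[OF cont zero]) auto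
    ultimately show ?thesis by (simp add: algebra_simps)
  qed
  thus ?thesis
    using has_vector_derivative_transform_within_open[OF D, of "{x/2<..<B}" "tail_integral \<psi>"] x B by auto
qed

section \<open>Uniqueness from vanishing moments\<close>

text \<open>Approximate \<open>q\<close> itself uniformly by a polynomial p. Since p is orthogonal
  to \<open>q\<close>, the integral of q^2 equals that of (q - p) q, which is at most e times the
  integral of |q|.\<close>

lemma zero_moments_real:
  fixes q :: "real \<Rightarrow> real"
  assumes b: "0 < b" and cont: "continuous_on {0..b} q"
    and mom: "\<And>k::nat. integral {0..b} (\<lambda>x. x ^ k * q x) = 0"
    and x: "x \<in> {0..b}"
  shows "q x = 0"
proof -
  have int: "(\<lambda>x. p x * q x) integrable_on {0..b}" if "continuous_on {0..b} p" for p
    by (intro integrable_continuous_real continuous_intros cont that)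
  define C where "C = integral {0..b} (\<lambda>x. \<bar>q x\<bar>)"
  have C: "C \<ge> 0" unfolding C_def
    by (intro integral_nonneg integrable_continuous_real continuous_intros cont) auto
  have bound: "integral {0..b} (\<lambda>x. q x * q x) \<le> e * C" if e: "e > 0" for e
  proof -
    obtain p where p: "real_polynomial_function p" "\<And>x. x \<in> {0..b} \<Longrightarrow> \<bar>q x - p x\<bar> < e"
      using Stone_Weierstrass_real_polynomial_function[of "{0..b}" q e] cont e by blast
    obtain a n where p_eq: "p = (\<lambda>x. \<Sum>i\<le>n. a i * x ^ i)"
      using p(1) real_polynomial_function_iff_sum by blast
    have cp: "continuous_on {0..b} p" unfolding p_eq by (intro continuous_intros)
    have "integral {0..b} (\<lambda>x. p x * q x) = (\<Sum>i\<le>n. integral {0..b} (\<lambda>x. a i * (x ^ i * q x)))"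
      unfolding p_eq sum_distrib_right mult.assoc
      by (intro integral_sum) (auto intro!: integrable_continuous_real continuous_intros cont)
    hence p0: "integral {0..b} (\<lambda>x. p x * q x) = 0" by (simp add: mom)
    have "integral {0..b} (\<lambda>x. q x * q x) = integral {0..b} (\<lambda>x. (q x - p x) * q x)"
      using p0 integral_diff[OF int[OF cont] int[OF cp]] by (simp add: algebra_simps)
    also have "\<dots> \<le> integral {0..b} (\<lambda>x. e * \<bar>q x\<bar>)"
    proof (rule integral_le)
      show "(\<lambda>x. (q x - p x) * q x) integrable_on {0..b}"
        by (intro int continuous_intros cont cp)
      show "(\<lambda>x. e * \<bar>q x\<bar>) integrable_on {0..b}"
        by (intro integrable_continuous_real continuous_intros cont)
      fix x assume "x \<in> {0..b}"
      hence "\<bar>(q x - p x) * q x\<bar> \<le> e * \<bar>q x\<bar>"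
        using p(2)[of x] by (subst abs_mult, intro mult_right_mono) simp_all
      thus "(q x - p x) * q x \<le> e * \<bar>q x\<bar>" by simp
    qed
    also have "\<dots> = e * C" by (simp add: C_def)
    finally show ?thesis .
  qed
  have "integral {0..b} (\<lambda>x. q x * q x) \<le> 0"
  proof (rule field_le_epsilon)
    fix e :: real assume e: "e > 0"
    have "e / (C + 1) * C \<le> e" using C e by (simp add: field_simps)
    moreover have "e / (C + 1) > 0" using C e by simp
    ultimately show "integral {0..b} (\<lambda>x. q x * q x) \<le> 0 + e"
      using bound[of "e / (C + 1)"] by linarith
  qed
  moreover have "integral {0..b} (\<lambda>x. q x * q x) \<ge> 0"
    by (intro integral_nonneg int cont) auto
  ultimately have "integral {0..b} (\<lambda>x. q x * q x) = 0" by simp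
  hence "\<forall>x\<in>{0..b}. q x * q x = 0"
    using b by (subst (asm) integral_eq_0_iff) (auto intro!: continuous_intros cont)
  thus ?thesis using x by auto
qed

lemma zero_moments_complex:
  fixes Q :: "real \<Rightarrow> complex"
  assumes b: "0 < b" and cont: "continuous_on {0..b} Q"
    and mom: "\<And>k::nat. integral {0..b} (\<lambda>x. of_real (x ^ k) * Q x) = 0"
    and x: "x \<in> {0..b}"
  shows "Q x = 0"
proof -
  have HI: "((\<lambda>x. of_real (x ^ k) * Q x) has_integral 0) {0..b}" for k :: nat
  proof -
    have "(\<lambda>x. of_real (x ^ k) * Q x) integrable_on {0..b}"
      by (intro integrable_continuous_real continuous_intros cont)
    thus ?thesis using mom[of k] by (simp add: has_integral_integrable_integral)
  qed
  have "Re (Q x) = 0"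
  proof (rule zero_moments_real[OF b _ _ x])
    show "continuous_on {0..b} (\<lambda>x. Re (Q x))" by (intro continuous_intros cont)
    show "integral {0..b} (\<lambda>x. x ^ k * Re (Q x)) = 0" for k :: nat
      using has_integral_linear[OF HI[of k] bounded_linear_Re] by (simp add: o_def integral_unique)
  qed
  moreover have "Im (Q x) = 0"
  proof (rule zero_moments_real[OF b _ _ x])
    show "continuous_on {0..b} (\<lambda>x. Im (Q x))" by (intro continuous_intros cont)
    show "integral {0..b} (\<lambda>x. x ^ k * Im (Q x)) = 0" for k :: nat
      using has_integral_linear[OF HI[of k] bounded_linear_Im] by (simp add: o_def integral_unique)
  qed
  ultimately show ?thesis by (simp add: complex_eq_iff)
qed

text \<open>Nothing bounds \<open>d\<close> near 0, so the moment theorem on the closed interval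
  cannot be applied to \<open>d\<close>. A power of x makes it integrable at 0, and a tail integral
  then makes it continuous there; \<open>d\<close> is recovered by differentiation.\<close>

lemma mellin_eq_zero_imp_zero:
  fixes d :: "real \<Rightarrow> complex"
  assumes b: "b > 0" and cont: "continuous_on {0<..} d" and zero: "\<And>x. x \<ge> b \<Longrightarrow> d x = 0"
    and conv: "\<And>s. s > s0 \<Longrightarrow> mellin_converges d (of_real s)"
    and mz: "\<And>s. s > s0 \<Longrightarrow> mellin d (of_real s) = 0"
    and x: "x > 0"
  shows "d x = 0"
proof (cases "x < b")
  case False thus ?thesis using zero by simp
next
  case xb: True
  \<comment> \<open>Multiplying by x^M moves the half-line s > s0 to cover s > 0, which contains s =
    1 (plain integrability) and all integers needed for the moments.\<close>
  define M where "M = max s0 0"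
  define \<phi> where "\<phi> x = of_real (x powr M) * d x" for x
  have \<phi>_conv: "mellin_converges \<phi> (of_real s)" and \<phi>_zero: "mellin \<phi> (of_real s) = 0"
    if "s > 0" for s
    using conv[of "s + M"] mz[of "s + M"] that
    unfolding \<phi>_def mellin_converges_powr_mult mellin_powr_mult by (auto simp: M_def)
  have \<phi>_cont: "continuous_on {0<..} \<phi>"
    unfolding \<phi>_def by (intro continuous_intros cont) auto
  have \<phi>_b: "\<phi> x = 0" if "x \<ge> b" for x using zero[OF that] by (simp add: \<phi>_def)
  have "mellin_converges \<phi> (of_real 1)" by (rule \<phi>_conv) simp
  hence "set_integrable lborel {0<..} \<phi>"
    unfolding mellin_converges_def
    by (rule iffD1[OF set_integrable_cong, rotated -1]) auto
  hence "set_integrable lborel {0<..b} \<phi>" by (rule set_integrable_subset) auto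
  hence "\<phi> integrable_on {0<..b}" by (rule set_borel_integral_eq_integral)
  hence \<phi>_int: "\<phi> integrable_on {0..b}"
    by (rule integrable_spike_set) (rule negligible_subset[of "{0}"]; auto)+
  define Q where "Q x = integral {x..b} \<phi>" for x
  have Q_cont: "continuous_on {0..b} Q" unfolding Q_def
    by (rule indefinite_integral_continuous_1'[OF \<phi>_int])
  have Q_eq: "tail_integral \<phi> x = Q x" if "x > 0" "x \<le> b" for x
    unfolding Q_def by (rule tail_integral_eq_integral[where b = b]) (use that \<phi>_cont \<phi>_b in auto)
  \<comment> \<open>The k-th moment of \<open>Q\<close> is its Mellin transform at k+1, hence that
    of \<phi> at k+2 divided by k+1.\<close>
  have mom: "integral {0..b} (\<lambda>x. of_real (x ^ k) * Q x) = 0" for k :: nat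
  proof -
    have "set_integrable lborel {0..b} (\<lambda>x. of_real (x ^ k) * Q x)"
      by (intro borel_integrable_atLeastAtMost' continuous_intros Q_cont)
    hence "integral {0..b} (\<lambda>x. of_real (x ^ k) * Q x) = (LBINT x:{0..b}. of_real (x ^ k) * Q x)"
      by (simp add: set_borel_integral_eq_integral)
    also have "\<dots> = mellin (tail_integral \<phi>) (of_real (real k + 1))"
      unfolding mellin_def set_lebesgue_integral_def
    proof (rule integral_discrete_difference[of "{0}"])
      fix x :: real assume "x \<notin> {0}"
      hence "x \<noteq> 0" by simp
      have "complex_of_real x powr (of_real (real k + 1) - 1) = of_real (x ^ k)" if "x > 0"
        using of_real_powr_minus_1[OF that, of "real k + 1"] that by (simp add: powr_realpow)
      thus "indicator {0..b} x *\<^sub>R (of_real (x ^ k) * Q x) = indicator {0<..} x *\<^sub>R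
          (complex_of_real x powr (of_real (real k + 1) - 1) * tail_integral \<phi> x)"
        using \<open>x \<noteq> 0\<close> Q_eq[of x] tail_integral_zero[OF \<phi>_b, of x] by (auto simp: indicator_def)
    qed auto
    also have "\<dots> = mellin \<phi> (of_real (real k + 1 + 1)) / of_real (real k + 1)"
      by (intro mellin_tail_integral(2) \<phi>_conv) auto
    also have "\<dots> = 0" using \<phi>_zero[of "real k + 1 + 1"] by simp
    finally show ?thesis .
  qed
  have T0: "0 = tail_integral \<phi> y" if "y \<in> {0<..<b}" for y
    using Q_eq[of y] zero_moments_complex[OF b Q_cont mom, of y] that by auto
  have "((\<lambda>_. 0) has_vector_derivative (0::complex)) (at x)" by simp
  hence "(tail_integral \<phi> has_vector_derivative 0) (at x)"
    by (rule has_vector_derivative_transform_within_open[of _ _ _ "{0<..<b}"]) (use T0 x xb in auto)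
  moreover have "(tail_integral \<phi> has_vector_derivative - \<phi> x) (at x)"
    by (rule has_vector_derivative_tail_integral[OF \<phi>_cont \<phi>_b x])
  ultimately have "\<phi> x = 0" using vector_derivative_unique_at by fastforce
  thus ?thesis using x by (simp add: \<phi>_def)
qed

subsection \<open>The kernel of the fractional Bessel integral\<close>

lemma borel_measurable_hyp_2F1 [measurable]: "hyp_2F1 a b c \<in> borel_measurable borel"
proof -
  have "(\<lambda>z. \<Sum>k. pochhammer a k * pochhammer b k / (pochhammer c k * fact k) * z ^ k) \<in> borel_measurable borel"
    by measurable
  thus ?thesis by (subst (asm) hyp_2F1_eq_suminf[symmetric])
qed

text \<open>The kernel of the fractional integral after y = xu, with the power of x split off: the
  power factor contributes x^(2\<beta>-1) and dy another x.\<close>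

definition bessel_kernel :: "real \<Rightarrow> real \<Rightarrow> real \<Rightarrow> real" where
  "bessel_kernel \<nu> \<beta> u = 1 / Gamma (2 * \<beta>) * (((u\<^sup>2 - 1) / (2 * u)) powr (2 * \<beta> - 1) *
     hyp_2F1 (\<beta> + (\<nu> - 1) / 2) \<beta> (2 * \<beta>) (1 - 1 / u\<^sup>2))"

lemma borel_measurable_bessel_kernel [measurable]: "bessel_kernel \<nu> \<beta> \<in> borel_measurable borel"
  unfolding bessel_kernel_def by measurable

lemma bessel_integral_eq_dil_conv:
  assumes x: "x > 0"
  shows "bessel_integral \<nu> \<beta> f x = of_real (x powr (2 * \<beta>)) * dil_conv (bessel_kernel \<nu> \<beta>) f x"
proof -
  have eq: "((x * u)\<^sup>2 - x\<^sup>2) / (2 * (x * u)) = x * ((u\<^sup>2 - 1) / (2 * u))"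
    "x\<^sup>2 / (x * u)\<^sup>2 = 1 / u\<^sup>2" if "u > 1" for u
    using x that by (simp_all add: field_simps power2_eq_square)
  have "bessel_integral \<nu> \<beta> f x = of_real (1 / Gamma (2 * \<beta>)) * (of_real x * (LBINT u:{1<..}.
        of_real ((((x * u)\<^sup>2 - x\<^sup>2) / (2 * (x * u))) powr (2 * \<beta> - 1) *
                 hyp_2F1 (\<beta> + (\<nu> - 1) / 2) \<beta> (2 * \<beta>) (1 - x\<^sup>2 / (x * u)\<^sup>2)) * f (x * u)))"
    unfolding bessel_integral_def by (subst set_integral_dilation[OF x]) simp
  also have "\<dots> = of_real (1 / Gamma (2 * \<beta>)) * (of_real x * (LBINT u:{1<..}.
       of_real (Gamma (2 * \<beta>) * x powr (2 * \<beta> - 1)) * (of_real (bessel_kernel \<nu> \<beta> u) * f (x * u))))"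
    if "Gamma (2 * \<beta>) \<noteq> 0"
  proof -
    have "complex_of_real ((((x * u)\<^sup>2 - x\<^sup>2) / (2 * (x * u))) powr (2 * \<beta> - 1) *
                 hyp_2F1 (\<beta> + (\<nu> - 1) / 2) \<beta> (2 * \<beta>) (1 - x\<^sup>2 / (x * u)\<^sup>2)) * f (x * u)
        = of_real (Gamma (2 * \<beta>) * x powr (2 * \<beta> - 1)) * (of_real (bessel_kernel \<nu> \<beta> u) * f (x * u))"
      if u: "u \<in> {1<..}" for u
    proof -
      have pos: "(u\<^sup>2 - 1) / (2 * u) \<ge> 0" using u by simp
      show ?thesis using u \<open>Gamma (2 * \<beta>) \<noteq> 0\<close> x pos
        by (subst eq(1), simp, subst eq(2), simp, subst powr_mult)
           (simp_all add: bessel_kernel_def)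
    qed
    thus ?thesis by (intro arg_cong2[of _ _ _ _ "(*)"] refl set_lebesgue_integral_cong) auto
  qed
  finally have A: "bessel_integral \<nu> \<beta> f x = of_real (1 / Gamma (2 * \<beta>)) * (of_real x *
      (of_real (Gamma (2 * \<beta>) * x powr (2 * \<beta> - 1)) * dil_conv (bessel_kernel \<nu> \<beta>) f x))"
    if "Gamma (2 * \<beta>) \<noteq> 0" using that by (simp add: dil_conv_def)
  have xx: "x * x powr (2 * \<beta> - 1) = x powr (2 * \<beta>)" using x by (simp add: powr_diff)
  show ?thesis
  \<comment> \<open>\<beta> is arbitrary here, so 2\<beta> may be a pole, where \<open>Gamma\<close>
    is 0 by convention; then 1/0 = 0 makes both sides vanish.\<close>
  proof (cases "Gamma (2 * \<beta>) = 0")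
    case True
    have "bessel_integral \<nu> \<beta> f x = 0" by (simp add: bessel_integral_def True)
    moreover have "dil_conv (bessel_kernel \<nu> \<beta>) f x = 0"
      by (simp add: dil_conv_def bessel_kernel_def True set_lebesgue_integral_def)
    ultimately show ?thesis by simp
  next
    case False
    thus ?thesis using A[OF False] unfolding xx[symmetric] by simp
  qed
qed

text \<open>The exponent is -(s + 2\<beta>) and not -s because the factor x^(2\<beta>) in front of
  the convolution shifts the Mellin variable.\<close>

lemma bessel_kernel_moment:
  fixes \<nu> \<beta> s :: real
  assumes \<nu>: "\<nu> \<ge> 0" and \<beta>: "\<beta> > 0" and s: "s > max 0 (\<nu> - 1)"
  shows "set_integrable lborel {1<..} (\<lambda>u. u powr (- (s + 2 * \<beta>)) * bessel_kernel \<nu> \<beta> u)"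
    and "(LBINT u:{1<..}. u powr (- (s + 2 * \<beta>)) * bessel_kernel \<nu> \<beta> u)
        = 1 / 2 powr (2 * \<beta>) * (Gamma (s / 2) * Gamma (s / 2 - (\<nu> - 1) / 2) /
            (Gamma (\<beta> + s / 2 - (\<nu> - 1) / 2) * Gamma (\<beta> + s / 2)))"
proof -
  define a where "a = \<beta> + (\<nu> - 1) / 2"
  define f where "f u = u powr (- (s + 2 * \<beta>)) * bessel_kernel \<nu> \<beta> u" for u
  define g where "g z = (1 - z) powr (- 1 / 2)" for z :: real
  define g' where "g' z = 1 / 2 * (1 - z) powr (- 3 / 2)" for z :: real
  define h where "h z = z powr (2 * \<beta> - 1) * (1 - z) powr (s / 2 - 1) * hyp_2F1 a \<beta> (2 * \<beta>) z" for z
  define c where "c = 1 / (Gamma (2 * \<beta>) * 2 powr (2 * \<beta>))"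
  \<comment> \<open>In fact a > -1/2, but a < 0 occurs for \<nu> < 1 and small \<beta>. This is why
    the binomial lemmas admit negative parameters above -1.\<close>
  have a: "a > -1" using \<nu> \<beta> by (simp add: a_def field_simps)
  have hyp: "2 * \<beta> + s / 2 - \<beta> > max a 0" using \<nu> \<beta> s by (auto simp: a_def max_def field_simps split: if_splits)
  have h_int: "set_integrable lborel {0<..<1} h"
    unfolding h_def by (rule hyp_2F1_Beta_integral(1)[OF a]) (use \<beta> s hyp in auto)
  have h_val: "(LBINT z:{0<..<1}. h z) = Gamma (2 * \<beta>) * Gamma (s / 2) * Gamma (2 * \<beta> + s / 2 - a - \<beta>)
      / (Gamma (2 * \<beta> + s / 2 - \<beta>) * Gamma (2 * \<beta> + s / 2 - a))"
    unfolding h_def by (rule hyp_2F1_Beta_integral(2)[OF a]) (use \<beta> s hyp in auto)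
  have der: "(g has_field_derivative g' z) (at z within {0<..<1})" if "z \<in> {0<..<1}" for z
    unfolding g_def g'_def using that
    by (auto intro!: derivative_eq_intros simp: powr_diff field_simps)
  have g_inv: "1 - 1 / (g z)\<^sup>2 = z" and g_gt: "g z > 1" if "z \<in> {0<..<1}" for z
  proof -
    have "(g z)\<^sup>2 = (1 - z) powr (- 1)"
      using that by (simp add: g_def power2_eq_square flip: powr_add)
    hence "(g z)\<^sup>2 = 1 / (1 - z)" using that by (simp add: powr_minus_divide)
    thus "1 - 1 / (g z)\<^sup>2 = z" by simp
    have "1 < (1 - z) powr (- 1 / 2)" using that powr_less_mono2_neg[of "-1/2" "1 - z" 1] by simp
    thus "g z > 1" by (simp add: g_def)
  qed
  have inj: "inj_on g {0<..<1}" by (rule inj_on_inverseI[where g = "\<lambda>u. 1 - 1 / u\<^sup>2"]) (rule g_inv)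
  have img: "g ` {0<..<1} = {1<..}"
  proof (intro equalityI subsetI)
    fix u :: real assume u: "u \<in> {1<..}"
    define z where "z = 1 - 1 / u\<^sup>2"
    have "u\<^sup>2 > 1" using u by (simp add: one_less_power)
    hence z: "z \<in> {0<..<1}" using u by (simp add: z_def divide_less_eq_1)
    have "1 - z = u powr (- 2)" using u powr_minus_divide[of u 2] by (simp add: z_def)
    hence "g z = u" using u by (simp add: g_def powr_powr)
    thus "u \<in> g ` {0<..<1}" using z by blast
  qed (use g_gt in auto)
  \<comment> \<open>The powers of 1 - z add up as -3/2 from the Jacobian, s/2 + \<beta> from the
    moment weight and 1/2 - \<beta> from the kernel, in total s/2 - 1. The 1/2 of the Jacobian
    completes 2^(-(2\<beta>-1)) to 2^(-2\<beta>).\<close>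
  have fg: "\<bar>g' z\<bar> * f (g z) = c * h z" if z: "z \<in> {0<..<1}" for z
  proof -
    define w where "w = 1 - z"
    have w: "w > 0" "w < 1" using z by (auto simp: w_def)
    have gz: "g z > 0" using g_gt[OF z] by simp
    have "((g z)\<^sup>2 - 1) / (2 * g z) = z * (g z / 2)"
      using gz g_inv[OF z] by (simp add: field_simps power2_eq_square)
    hence gg: "((g z)\<^sup>2 - 1) / (2 * g z) = z * w powr (- 1 / 2) / 2" unfolding g_def w_def by simp
    have k: "bessel_kernel \<nu> \<beta> (g z) = 1 / Gamma (2 * \<beta>) * ((z * w powr (- 1 / 2) / 2) powr (2 * \<beta> - 1)
        * hyp_2F1 a \<beta> (2 * \<beta>) z)"
      unfolding bessel_kernel_def g_inv[OF z] gg a_def by (rule refl)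
    have e1: "(z * w powr (- 1 / 2) / 2) powr (2 * \<beta> - 1)
        = z powr (2 * \<beta> - 1) * w powr (- 1 / 2 * (2 * \<beta> - 1)) / 2 powr (2 * \<beta> - 1)"
      using z w by (simp add: powr_divide powr_mult powr_powr)
    have e2: "(g z) powr (- (s + 2 * \<beta>)) = w powr (- 1 / 2 * (- (s + 2 * \<beta>)))"
      by (simp add: g_def w_def powr_powr)
    have e3: "\<bar>g' z\<bar> = 1 / 2 * w powr (- 3 / 2)" by (simp add: g'_def w_def)
    have e4: "w powr (- 3 / 2) * w powr (- 1 / 2 * (- (s + 2 * \<beta>))) * w powr (- 1 / 2 * (2 * \<beta> - 1))
        = w powr (s / 2 - 1)"
    proof -
      have "- 3 / 2 + - 1 / 2 * (- (s + 2 * \<beta>)) + - 1 / 2 * (2 * \<beta> - 1) = s / 2 - 1"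
        by (simp add: field_simps)
      thus ?thesis by (simp only: powr_add[symmetric])
    qed
    have e5: "(2::real) * 2 powr (2 * \<beta> - 1) = 2 powr (2 * \<beta>)" by (simp add: powr_diff)
    show ?thesis
      unfolding f_def k h_def c_def w_def[symmetric] e1 e2 e3 e4[symmetric] e5[symmetric] by (simp add: mult_ac)
  qed
  have "set_integrable lborel {0<..<1} (\<lambda>z. \<bar>g' z\<bar> * f (g z))"
    using h_int by (subst set_integrable_cong[OF refl refl fg]) auto
  hence A: "(\<lambda>z. \<bar>g' z\<bar> * f (g z)) absolutely_integrable_on {0<..<1}"
    by (auto simp: set_integrable_def integrable_completion)
  have "integral {0<..<1} (\<lambda>z. \<bar>g' z\<bar> * f (g z)) = integral {0<..<1} (\<lambda>z. c * h z)"
    using fg by (intro integral_cong) auto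
  also have "\<dots> = c * (LBINT z:{0<..<1}. h z)"
    using set_borel_integral_eq_integral[OF h_int] by simp
  finally have A2: "integral {0<..<1} (\<lambda>z. \<bar>g' z\<bar> * f (g z)) = c * (LBINT z:{0<..<1}. h z)" .
  have B: "f absolutely_integrable_on {1<..} \<and> integral {1<..} f = c * (LBINT z:{0<..<1}. h z)"
  proof -
    have "(\<lambda>z. \<bar>g' z\<bar> * f (g z)) absolutely_integrable_on {0<..<1} \<and>
        integral {0<..<1} (\<lambda>z. \<bar>g' z\<bar> * f (g z)) = c * (LBINT z:{0<..<1}. h z) \<longleftrightarrow>
        f absolutely_integrable_on g ` {0<..<1} \<and> integral (g ` {0<..<1}) f = c * (LBINT z:{0<..<1}. h z)"
      by (rule has_absolute_integral_change_of_variables_1'[OF _ der inj]) auto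
    thus ?thesis using A A2 unfolding img by blast
  qed
  \<comment> \<open>The change of variables yields integrability for the completed measure; Borel
    measurability brings it back to \<open>lborel\<close>.\<close>
  have [measurable]: "f \<in> borel_measurable borel" unfolding f_def by measurable
  show f_int: "set_integrable lborel {1<..} (\<lambda>u. u powr (- (s + 2 * \<beta>)) * bessel_kernel \<nu> \<beta> u)"
    using B unfolding set_integrable_def f_def[symmetric] by (simp add: integrable_completion)
  have "(LBINT u:{1<..}. f u) = c * (LBINT z:{0<..<1}. h z)"
    using set_borel_integral_eq_integral(2)[OF f_int] B unfolding f_def by simp
  also have "\<dots> = 1 / 2 powr (2 * \<beta>) * (Gamma (s / 2) * Gamma (s / 2 - (\<nu> - 1) / 2) /
            (Gamma (\<beta> + s / 2 - (\<nu> - 1) / 2) * Gamma (\<beta> + s / 2)))"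
  proof -
    have "Gamma (2 * \<beta>) > 0" using \<beta> by simp
    moreover have e: "2 * \<beta> + s / 2 - a - \<beta> = s / 2 - (\<nu> - 1) / 2" "2 * \<beta> + s / 2 - \<beta> = \<beta> + s / 2"
      "2 * \<beta> + s / 2 - a = \<beta> + s / 2 - (\<nu> - 1) / 2" by (simp_all add: a_def)
    ultimately show ?thesis unfolding h_val c_def e by (simp add: mult_ac)
  qed
  finally show "(LBINT u:{1<..}. u powr (- (s + 2 * \<beta>)) * bessel_kernel \<nu> \<beta> u)
        = 1 / 2 powr (2 * \<beta>) * (Gamma (s / 2) * Gamma (s / 2 - (\<nu> - 1) / 2) /
            (Gamma (\<beta> + s / 2 - (\<nu> - 1) / 2) * Gamma (\<beta> + s / 2)))"
    unfolding f_def .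
qed

subsection \<open>Smooth functions with compact support in the semiaxis\<close>

lemma vderiv_transform:
  assumes eq: "\<And>y. y > 0 \<Longrightarrow> F y = G y" and G: "(G has_vector_derivative D) (at x)" and x: "x > 0"
  shows "(F has_vector_derivative D) (at x)" "vderiv F x = D"
proof -
  show *: "(F has_vector_derivative D) (at x)"
    by (rule has_vector_derivative_transform_within_open[OF G, of "{0<..}"]) (use eq x in auto)
  show "vderiv F x = D" unfolding vderiv_def by (rule vector_derivative_at[OF *])
qed

lemma has_vector_derivative_vderiv:
  assumes "smooth_on_semiaxis f" "x > 0"
  shows "((vderiv ^^ k) f has_vector_derivative (vderiv ^^ Suc k) f x) (at x)"
  using assms unfolding smooth_on_semiaxis_def vderiv_def funpow.simps o_def
  by (simp add: vector_derivative_works)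

text \<open>A class of functions closed under differentiation that contains the derivatives of \<open>f\<close> and
  \<open>B f\<close>: membership in it yields smoothness without a Leibniz rule for iterated derivatives.\<close>

inductive bessel_alg :: "(real \<Rightarrow> complex) \<Rightarrow> (real \<Rightarrow> complex) \<Rightarrow> bool" for f where
  deriv: "bessel_alg f ((vderiv ^^ k) f)"
| add: "bessel_alg f F \<Longrightarrow> bessel_alg f G \<Longrightarrow> bessel_alg f (\<lambda>x. F x + G x)"
| divide: "bessel_alg f F \<Longrightarrow> bessel_alg f (\<lambda>x. of_real (c / x) * F x)"

lemma bessel_alg_has_derivative:
  assumes f: "smooth_on_semiaxis f" and F: "bessel_alg f F"
  shows "\<exists>G. bessel_alg f G \<and> (\<forall>x>0. (F has_vector_derivative G x) (at x))"
  using F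
proof induction
  case (deriv k)
  show ?case using has_vector_derivative_vderiv[OF f] bessel_alg.deriv by blast
next
  case (add F G)
  then obtain F' G' where "bessel_alg f F'" "\<forall>x>0. (F has_vector_derivative F' x) (at x)"
    "bessel_alg f G'" "\<forall>x>0. (G has_vector_derivative G' x) (at x)" by blast
  thus ?case
    by (intro exI[of _ "\<lambda>x. F' x + G' x"]) (auto intro!: bessel_alg.add has_vector_derivative_add)
next
  case (divide F c)
  then obtain F' where F': "bessel_alg f F'" "\<And>x. x > 0 \<Longrightarrow> (F has_vector_derivative F' x) (at x)" by blast
  \<comment> \<open>The term -(c/x^2) F is written as (-1/x)((c/x) F), so that two uses of the rule
    \<open>divide\<close> put it into the class.\<close>
  have "((\<lambda>x. of_real (c / x) * F x) has_vector_derivative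
      (of_real (c / x) * F' x + of_real ((- 1) / x) * (of_real (c / x) * F x))) (at x)" if x: "x > 0" for x
  proof -
    have "((\<lambda>x. c / x) has_field_derivative (- (c / (x * x)))) (at x)"
      using x by (auto intro!: derivative_eq_intros)
    hence "((\<lambda>x. complex_of_real (c / x)) has_vector_derivative of_real (- (c / (x * x)))) (at x)"
      by (intro has_vector_derivative_of_real) (simp add: has_real_derivative_iff_has_vector_derivative)
    from has_vector_derivative_mult[OF this F'(2)[OF x]]
    show ?thesis by (rule has_vector_derivative_eq_rhs) (use x in \<open>simp add: field_simps\<close>)
  qed
  moreover have "bessel_alg f (\<lambda>x. of_real (c / x) * F' x + of_real ((- 1) / x) * (of_real (c / x) * F x))"
    by (intro bessel_alg.add bessel_alg.divide F' divide.hyps)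
  ultimately show ?case by blast
qed

text \<open>By induction each iterated derivative agrees with a member of the class, but only for x
  > 0: outside the semiaxis \<open>vderiv\<close> is uncontrolled. Agreement on an open set suffices
  for differentiability.\<close>

lemma smooth_bessel_alg:
  assumes f: "smooth_on_semiaxis f" and F: "bessel_alg f F"
  shows "smooth_on_semiaxis F"
proof -
  have *: "\<exists>G. bessel_alg f G \<and> (\<forall>x>0. (vderiv ^^ k) F x = G x)" for k
  proof (induction k)
    case 0
    show ?case using F by auto
  next
    case (Suc k)
    then obtain G where G: "bessel_alg f G" "\<And>x. x > 0 \<Longrightarrow> (vderiv ^^ k) F x = G x" by blast
    obtain H where H: "bessel_alg f H" "\<And>x. x > 0 \<Longrightarrow> (G has_vector_derivative H x) (at x)"
      using bessel_alg_has_derivative[OF f G(1)] by blast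
    show ?case using H(1) vderiv_transform(2)[OF G(2) H(2)] by auto
  qed
  show ?thesis unfolding smooth_on_semiaxis_def
  proof (intro allI impI)
    fix k and x :: real assume x: "x > 0"
    obtain G where G: "bessel_alg f G" "\<And>x. x > 0 \<Longrightarrow> (vderiv ^^ k) F x = G x" using * by blast
    obtain H where H: "\<And>x. x > 0 \<Longrightarrow> (G has_vector_derivative H x) (at x)"
      using bessel_alg_has_derivative[OF f G(1)] by blast
    show "(vderiv ^^ k) F differentiable at x"
      using vderiv_transform(1)[OF G(2) H x] x by (auto simp: has_vector_derivative_def differentiable_def)
  qed
qed

text \<open>Vanishing outside [a,b], rather than having support equal to it, is stable under
  differentiation and under B.\<close>

definition smooth_supported :: "real \<Rightarrow> real \<Rightarrow> (real \<Rightarrow> complex) \<Rightarrow> bool" where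
  "smooth_supported a b g \<longleftrightarrow> smooth_on_semiaxis g \<and> (\<forall>x>0. x \<notin> {a..b} \<longrightarrow> g x = 0)"

lemma smooth_supported_has_derivative:
  "smooth_supported a b g \<Longrightarrow> x > 0 \<Longrightarrow> (g has_vector_derivative vderiv g x) (at x)"
  using has_vector_derivative_vderiv[of g x 0] by (simp add: smooth_supported_def)

lemma smooth_supported_continuous:
  assumes "smooth_supported a b g"
  shows "continuous_on {0<..} g"
proof -
  have "isCont g x" if "x > 0" for x
    using has_vector_derivative_continuous[OF smooth_supported_has_derivative[OF assms that]] .
  thus ?thesis by (simp add: continuous_at_imp_continuous_on)
qed

lemma smooth_supported_vderiv:
  assumes g: "smooth_supported a b g"
  shows "smooth_supported a b (vderiv g)"
  unfolding smooth_supported_def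
proof (intro conjI allI impI)
  show "smooth_on_semiaxis (vderiv g)"
    using g unfolding smooth_supported_def smooth_on_semiaxis_def
    by (metis comp_apply funpow_Suc_right)
  fix x :: real assume x: "x > 0" "x \<notin> {a..b}"
  have "(g has_vector_derivative 0) (at x)"
    by (rule has_vector_derivative_transform_within_open[of "\<lambda>_. 0" _ _ "{0<..} \<inter> - {a..b}"])
       (use g x in \<open>auto simp: smooth_supported_def intro!: open_Int open_Compl\<close>)
  thus "vderiv g x = 0" by (simp add: vderiv_def vector_derivative_at)
qed

lemma smooth_supported_bessel_op:
  assumes g: "smooth_supported a b g"
  shows "smooth_supported a b (bessel_op \<nu> g)"
  unfolding smooth_supported_def
proof (intro conjI allI impI)
  have "bessel_alg g (\<lambda>x. (vderiv ^^ 2) g x + of_real (\<nu> / x) * (vderiv ^^ 1) g x)"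
    by (intro bessel_alg.intros)
  also have "(\<lambda>x. (vderiv ^^ 2) g x + of_real (\<nu> / x) * (vderiv ^^ 1) g x) = bessel_op \<nu> g"
    by (simp add: bessel_op_def fun_eq_iff numeral_2_eq_2)
  finally show "smooth_on_semiaxis (bessel_op \<nu> g)"
    using smooth_bessel_alg[of g] g by (simp add: smooth_supported_def)
  fix x :: real assume x: "x > 0" "x \<notin> {a..b}"
  show "bessel_op \<nu> g x = 0"
    using smooth_supported_vderiv[OF g] smooth_supported_vderiv[OF smooth_supported_vderiv[OF g]] x
    by (simp add: smooth_supported_def bessel_op_def)
qed

section \<open>Mellin transforms of compactly supported functions and their derivatives\<close>

lemma mellin_supported:
  assumes cont: "continuous_on {0<..} g" and a: "0 < a" and zero: "\<And>x. x > 0 \<Longrightarrow> x \<notin> {a..b} \<Longrightarrow> g x = 0"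
  shows "mellin_converges g s"
    and "mellin g s = integral {a..b} (\<lambda>x. of_real x powr (s - 1) * g x)"
proof -
  have "continuous_on {a..b} (\<lambda>x. of_real x powr (s - 1) * g x)"
    using a by (intro continuous_intros continuous_on_subset[OF cont]) (auto simp: complex_nonpos_Reals_iff)
  hence int: "set_integrable lborel {a..b} (\<lambda>x. of_real x powr (s - 1) * g x)"
    by (rule borel_integrable_atLeastAtMost')
  have eq: "indicator {0<..} x *\<^sub>R (of_real x powr (s - 1) * g x)
      = indicator {a..b} x *\<^sub>R (of_real x powr (s - 1) * g x)" for x
    using zero[of x] a by (auto simp: indicator_def)
  show "mellin_converges g s" using int unfolding mellin_converges_def set_integrable_def eq .
  have "mellin g s = (LBINT x:{a..b}. of_real x powr (s - 1) * g x)"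
    unfolding mellin_def set_lebesgue_integral_def eq ..
  also have "\<dots> = integral {a..b} (\<lambda>x. of_real x powr (s - 1) * g x)"
    by (rule set_borel_integral_eq_integral[OF int])
  finally show "mellin g s = integral {a..b} (\<lambda>x. of_real x powr (s - 1) * g x)" .
qed

lemma smooth_supported_mellin_converges:
  "smooth_supported a b g \<Longrightarrow> a > 0 \<Longrightarrow> mellin_converges g s"
  by (rule mellin_supported(1)[OF smooth_supported_continuous]) (auto simp: smooth_supported_def)

lemma mellin_vderiv:
  assumes g: "smooth_supported a b g" and a: "0 < a" "a \<le> b"
  shows "mellin (vderiv g) (s + 1) = - s * mellin g s"
proof -
  \<comment> \<open>Integration by parts runs over an interval strictly larger than [a,b], where the
    boundary terms vanish by assumption; at \<open>a\<close> and \<open>b\<close> themselves that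
    would need a continuity argument.\<close>
  define A B where "A = a / 2" and "B = b + 1"
  have AB: "0 < A" "A < a" "b < B" "A \<le> B" using a by (auto simp: A_def B_def)
  have g0: "g x = 0" "vderiv g x = 0" if "x > 0" "x \<notin> {A..B}" for x
    using g smooth_supported_vderiv[OF g] that AB by (auto simp: smooth_supported_def)
  have D: "((\<lambda>x. of_real x powr s * g x) has_vector_derivative
      (of_real x powr s * vderiv g x + s * of_real x powr (s - 1) * g x)) (at x within {A..B})"
    if "x \<in> {A..B}" for x
  proof -
    have x: "x > 0" using that AB by simp
    have "((\<lambda>z. z powr s) has_field_derivative s * complex_of_real x powr (s - 1)) (at (of_real x))"
      using x by (intro has_field_derivative_powr) (auto simp: complex_nonpos_Reals_iff)
    hence "((\<lambda>x. complex_of_real x powr s) has_vector_derivative s * of_real x powr (s - 1)) (at x within {A..B})"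
      by (intro has_vector_derivative_real_field)
    from has_vector_derivative_mult[OF this has_vector_derivative_at_within[OF smooth_supported_has_derivative[OF g x]]]
    show ?thesis .
  qed
  have "((\<lambda>x. of_real x powr s * vderiv g x + s * of_real x powr (s - 1) * g x) has_integral
      (of_real B powr s * g B - of_real A powr s * g A)) {A..B}"
    by (rule fundamental_theorem_of_calculus[OF AB(4) D])
  moreover have "g A = 0" "g B = 0" using g AB a by (auto simp: smooth_supported_def)
  ultimately have I0: "integral {A..B} (\<lambda>x. of_real x powr s * vderiv g x + s * of_real x powr (s - 1) * g x) = 0"
    by (simp add: integral_unique)
  have c: "continuous_on {A..B} g" "continuous_on {A..B} (vderiv g)"
    using AB smooth_supported_continuous[OF g] smooth_supported_continuous[OF smooth_supported_vderiv[OF g]]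
    by (auto elim!: continuous_on_subset)
  have i1: "(\<lambda>x. of_real x powr s * vderiv g x) integrable_on {A..B}"
    and i2: "(\<lambda>x. s * (of_real x powr (s - 1) * g x)) integrable_on {A..B}"
    using AB by (auto intro!: integrable_continuous_real continuous_intros c simp: complex_nonpos_Reals_iff)
  have "mellin (vderiv g) (s + 1) = integral {A..B} (\<lambda>x. of_real x powr s * vderiv g x)"
    using mellin_supported(2)[OF smooth_supported_continuous[OF smooth_supported_vderiv[OF g]] AB(1) g0(2), where s = "s + 1"]
    by simp
  moreover have "mellin g s = integral {A..B} (\<lambda>x. of_real x powr (s - 1) * g x)"
    using mellin_supported(2)[OF smooth_supported_continuous[OF g] AB(1) g0(1), where s = s] by simp
  moreover have "integral {A..B} (\<lambda>x. of_real x powr s * vderiv g x + s * of_real x powr (s - 1) * g x)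
      = integral {A..B} (\<lambda>x. of_real x powr s * vderiv g x) + s * integral {A..B} (\<lambda>x. of_real x powr (s - 1) * g x)"
    using i1 i2 unfolding mult.assoc by (simp add: integral_add)
  ultimately show ?thesis using I0 by (simp add: add_eq_0_iff)
qed

text \<open>Two integrations by parts give s (s+1). In the first-order term 1/x lowers the exponent
  by one, and a single integration by parts gives -\<nu> s.\<close>

lemma mellin_bessel_op:
  assumes g: "smooth_supported a b g" and a: "0 < a" "a \<le> b"
  shows "mellin (bessel_op \<nu> g) (s + 2) = s * (s + 1 - of_real \<nu>) * mellin g s"
proof -
  note g' = smooth_supported_vderiv[OF g]
  note g'' = smooth_supported_vderiv[OF g']
  have eq: "of_real x powr (s + 2 - 1) * (of_real (\<nu> / x) * vderiv g x)
      = of_real \<nu> * (of_real x powr (s + 1 - 1) * vderiv g x)" if "x > 0" for x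
    using that powr_add[of "complex_of_real x" s 1] by (simp add: field_simps)
  have int1: "set_integrable lborel {0<..} (\<lambda>x. of_real x powr (s + 2 - 1) * vderiv (vderiv g) x)"
    using smooth_supported_mellin_converges[OF g'' a(1), of "s + 2"] unfolding mellin_converges_def .
  have int2: "set_integrable lborel {0<..} (\<lambda>x. of_real \<nu> * (of_real x powr (s + 1 - 1) * vderiv g x))"
    using smooth_supported_mellin_converges[OF g' a(1), of "s + 1"] unfolding mellin_converges_def by simp
  have "mellin (bessel_op \<nu> g) (s + 2) = (LBINT x:{0<..}. of_real x powr (s + 2 - 1) * vderiv (vderiv g) x
      + of_real \<nu> * (of_real x powr (s + 1 - 1) * vderiv g x))"
    unfolding mellin_def
  proof (rule set_lebesgue_integral_cong)
    show "\<forall>x. x \<in> {0<..} \<longrightarrow> of_real x powr (s + 2 - 1) * bessel_op \<nu> g x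
        = of_real x powr (s + 2 - 1) * vderiv (vderiv g) x + of_real \<nu> * (of_real x powr (s + 1 - 1) * vderiv g x)"
      unfolding bessel_op_def distrib_left greaterThan_iff using eq by simp
  qed simp
  also have "\<dots> = mellin (vderiv (vderiv g)) (s + 1 + 1) + of_real \<nu> * mellin (vderiv g) (s + 1)"
    using int1 int2 by (subst set_integral_add(2)) (simp_all add: mellin_def)
  also have "\<dots> = s * (s + 1 - of_real \<nu>) * mellin g s"
    unfolding mellin_vderiv[OF g' a] mellin_vderiv[OF g a] by (simp add: algebra_simps)
  finally show ?thesis .
qed

subsection \<open>Mellin transforms as holomorphic functions\<close>

lemma norm_of_real_powr:
  "x > 0 \<Longrightarrow> norm (complex_of_real x powr s) = x powr (Re s)"
  by (simp add: norm_powr_real_powr)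

lemma mellin_integrand_measurable:
  fixes \<phi> :: "real \<Rightarrow> complex" and s :: complex
  assumes "continuous_on {0<..} \<phi>"
  shows "set_borel_measurable borel {0<..} (\<lambda>x. of_real x powr (s - 1) * \<phi> x)"
  unfolding set_borel_measurable_def
  by (intro borel_measurable_continuous_on_indicator continuous_intros assms)
     (auto simp: complex_nonpos_Reals_iff)

lemma powr_le_scaled:
  fixes x b p q :: real
  assumes "0 < x" "x < b" "p \<le> q"
  shows "x powr q \<le> max 1 b powr (q - p) * x powr p"
proof -
  have "x powr q = x powr (q - p) * x powr p" using assms by (simp flip: powr_add)
  also have "\<dots> \<le> max 1 b powr (q - p) * x powr p"
    using assms by (intro mult_right_mono powr_mono2) auto
  finally show ?thesis .
qed

text \<open>Only small x matter, as \<phi> vanishes for large x, and there a larger exponent helps.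
  So the domain of convergence is a right half-plane, with or without its boundary line.\<close>

lemma mellin_converges_mono:
  assumes cont: "continuous_on {0<..} \<phi>" and zero: "\<And>x. x \<ge> b \<Longrightarrow> \<phi> x = 0"
    and s: "mellin_converges \<phi> s" and le: "Re s \<le> Re w"
  shows "mellin_converges \<phi> w"
proof -
  have "integrable lborel (\<lambda>x. max 1 b powr (Re w - Re s) *\<^sub>R
      norm (indicator {0<..} x *\<^sub>R (complex_of_real x powr (s - 1) * \<phi> x)))"
    using s unfolding mellin_converges_def set_integrable_def
    by (intro integrable_scaleR_right integrable_norm)
  thus ?thesis unfolding mellin_converges_def set_integrable_def
  proof (rule Bochner_Integration.integrable_bound)
    show "(\<lambda>x. indicator {0<..} x *\<^sub>R (complex_of_real x powr (w - 1) * \<phi> x)) \<in> borel_measurable lborel"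
      using mellin_integrand_measurable[OF cont] by (simp add: set_borel_measurable_def)
    show "AE x in lborel. norm (indicator {0<..} x *\<^sub>R (complex_of_real x powr (w - 1) * \<phi> x))
        \<le> norm (max 1 b powr (Re w - Re s) *\<^sub>R
            norm (indicator {0<..} x *\<^sub>R (complex_of_real x powr (s - 1) * \<phi> x)))"
    proof (rule AE_I2)
      fix x :: real
      show "norm (indicator {0<..} x *\<^sub>R (complex_of_real x powr (w - 1) * \<phi> x))
        \<le> norm (max 1 b powr (Re w - Re s) *\<^sub>R
            norm (indicator {0<..} x *\<^sub>R (complex_of_real x powr (s - 1) * \<phi> x)))"
      proof (cases "0 < x \<and> x < b")
        case True
        have "x powr (Re w - 1) \<le> max 1 b powr ((Re w - 1) - (Re s - 1)) * x powr (Re s - 1)"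
          using True le by (intro powr_le_scaled) auto
        hence "x powr (Re w - 1) * norm (\<phi> x) \<le> max 1 b powr (Re w - Re s) * x powr (Re s - 1) * norm (\<phi> x)"
          by (intro mult_right_mono) auto
        thus ?thesis using True by (simp add: norm_mult norm_of_real_powr mult.assoc)
      qed (use zero in \<open>auto simp: indicator_def\<close>)
    qed
  qed
qed

text \<open>Dominated convergence from the right: raising the exponent by at most 1 enlarges the
  integrand on (0,b) at most by the factor max 1 b, so the integrand at \<open>s\<close> itself
  supplies the majorant.\<close>

lemma mellin_tendsto_boundary:
  assumes cont: "continuous_on {0<..} \<phi>" and zero: "\<And>x. x \<ge> b \<Longrightarrow> \<phi> x = 0"
    and s: "mellin_converges \<phi> s"
  shows "(\<lambda>n. mellin \<phi> (s + of_real (1 / real (Suc n)))) \<longlonglongrightarrow> mellin \<phi> s"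
  unfolding mellin_def set_lebesgue_integral_def
proof (rule integral_dominated_convergence)
  have meas: "(\<lambda>x. indicator {0<..} x *\<^sub>R (complex_of_real x powr (w - 1) * \<phi> x)) \<in> borel_measurable lborel" for w
    using mellin_integrand_measurable[OF cont] by (simp add: set_borel_measurable_def)
  show "(\<lambda>x. indicator {0<..} x *\<^sub>R (complex_of_real x powr (s - 1) * \<phi> x)) \<in> borel_measurable lborel"
    and "(\<lambda>x. indicator {0<..} x *\<^sub>R (complex_of_real x powr (s + of_real (1 / real (Suc n)) - 1) * \<phi> x))
          \<in> borel_measurable lborel" for n by (rule meas)+
  show "integrable lborel (\<lambda>x. max 1 b * norm (indicator {0<..} x *\<^sub>R (complex_of_real x powr (s - 1) * \<phi> x)))"
    using s unfolding mellin_converges_def set_integrable_def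
    by (intro integrable_mult_right integrable_norm)
  show "AE x in lborel. (\<lambda>n. indicator {0<..} x *\<^sub>R (complex_of_real x powr (s + of_real (1 / real (Suc n)) - 1) * \<phi> x))
      \<longlonglongrightarrow> indicator {0<..} x *\<^sub>R (complex_of_real x powr (s - 1) * \<phi> x)"
  proof (rule AE_I2)
    fix x :: real
    show "(\<lambda>n. indicator {0<..} x *\<^sub>R (complex_of_real x powr (s + of_real (1 / real (Suc n)) - 1) * \<phi> x))
      \<longlonglongrightarrow> indicator {0<..} x *\<^sub>R (complex_of_real x powr (s - 1) * \<phi> x)"
    proof (cases "x > 0")
      case True
      have "(\<lambda>n. s + complex_of_real (1 / real (Suc n)) - 1) \<longlonglongrightarrow> s + of_real 0 - 1"
        by (intro tendsto_intros LIMSEQ_Suc[OF lim_1_over_n])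
      hence "(\<lambda>n. complex_of_real x powr (s + complex_of_real (1 / real (Suc n)) - 1))
          \<longlonglongrightarrow> complex_of_real x powr (s + of_real 0 - 1)"
        using True by (intro tendsto_powr_complex tendsto_const) (simp_all add: complex_nonpos_Reals_iff)
      hence "(\<lambda>n. complex_of_real x powr (s + complex_of_real (1 / real (Suc n)) - 1))
          \<longlonglongrightarrow> complex_of_real x powr (s - 1)"
        by (simp only: of_real_0 add_0_right)
      thus ?thesis by (rule tendsto_scaleR[OF tendsto_const tendsto_mult[OF _ tendsto_const]])
    qed simp
  qed
  show "AE x in lborel. norm (indicator {0<..} x *\<^sub>R (complex_of_real x powr (s + of_real (1 / real (Suc n)) - 1) * \<phi> x))
      \<le> max 1 b * norm (indicator {0<..} x *\<^sub>R (complex_of_real x powr (s - 1) * \<phi> x))" for n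
  proof (rule AE_I2)
    fix x :: real
    show "norm (indicator {0<..} x *\<^sub>R (complex_of_real x powr (s + of_real (1 / real (Suc n)) - 1) * \<phi> x))
      \<le> max 1 b * norm (indicator {0<..} x *\<^sub>R (complex_of_real x powr (s - 1) * \<phi> x))"
    proof (cases "0 < x \<and> x < b")
      case True
      have "x powr (Re s + 1 / real (Suc n) - 1)
          \<le> max 1 b powr ((Re s + 1 / real (Suc n) - 1) - (Re s - 1)) * x powr (Re s - 1)"
        using True by (intro powr_le_scaled) auto
      also have "max 1 b powr ((Re s + 1 / real (Suc n) - 1) - (Re s - 1)) \<le> max 1 b powr 1"
        by (intro powr_mono) auto
      finally have "x powr (Re s + 1 / real (Suc n) - 1) * norm (\<phi> x) \<le> max 1 b * x powr (Re s - 1) * norm (\<phi> x)"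
        by (intro mult_right_mono) (auto simp: mult_right_mono)
      thus ?thesis using True by (simp add: norm_mult norm_of_real_powr mult.assoc)
    qed (use zero in \<open>auto simp: indicator_def\<close>)
  qed
qed

text \<open>Majorant for differentiating x^w in w. With L = ln x the right-hand side is
  (x^(2\<delta>) + x^(-2\<delta>)) / \<delta>, so the logarithm is paid for by integrands at w +
  2\<delta> and w - 2\<delta>. It follows from |e^z - 1| \<le> |z| e^|Re z| and \<delta>|L| \<le>
  e^(\<delta>|L|).\<close>

lemma norm_exp_quotient_le:
  fixes h :: complex and L \<delta> :: real
  assumes h: "h \<noteq> 0" "norm h \<le> \<delta>"
  shows "norm ((exp (h * of_real L) - 1) / h) \<le> 1 / \<delta> * (exp (2 * \<delta> * L) + exp (- 2 * \<delta> * L))"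
proof -
  have \<delta>: "\<delta> > 0" using h by (meson norm_le_zero_iff not_le order_trans)
  have "norm (exp (h * of_real L) - 1) \<le> exp \<bar>Re (h * of_real L)\<bar> * norm (h * of_real L)"
    using Taylor_exp[of "h * of_real L" 0] by simp
  also have "\<bar>Re (h * of_real L)\<bar> \<le> \<delta> * \<bar>L\<bar>"
    using abs_Re_le_cmod[of h] h by (simp add: abs_mult mult_right_mono)
  finally have "norm (exp (h * of_real L) - 1) \<le> exp (\<delta> * \<bar>L\<bar>) * (norm h * \<bar>L\<bar>)"
    by (simp add: norm_mult mult_right_mono)
  hence "norm ((exp (h * of_real L) - 1) / h) \<le> exp (\<delta> * \<bar>L\<bar>) * \<bar>L\<bar>"
    using h by (simp add: norm_divide divide_le_eq mult_ac)
  also have "\<dots> \<le> exp (\<delta> * \<bar>L\<bar>) * (exp (\<delta> * \<bar>L\<bar>) / \<delta>)"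
  proof -
    have "\<delta> * \<bar>L\<bar> \<le> exp (\<delta> * \<bar>L\<bar>)" using exp_ge_add_one_self[of "\<delta> * \<bar>L\<bar>"] by linarith
    hence "\<bar>L\<bar> \<le> exp (\<delta> * \<bar>L\<bar>) / \<delta>" using \<delta> by (simp add: field_simps)
    thus ?thesis by (intro mult_left_mono) auto
  qed
  also have "\<dots> = 1 / \<delta> * exp (2 * \<delta> * \<bar>L\<bar>)"
    by (simp add: field_simps flip: exp_add)
  also have "\<dots> \<le> 1 / \<delta> * (exp (2 * \<delta> * L) + exp (- 2 * \<delta> * L))"
    using \<delta> by (intro mult_left_mono) (auto simp: abs_if add_increasing add_increasing2)
  finally show ?thesis .
qed

lemma mellin_field_differentiable:
  assumes cont: "continuous_on {0<..} \<phi>"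
    and conv: "\<And>w. Re w \<ge> c \<Longrightarrow> mellin_converges \<phi> w" and w: "Re w > c"
  shows "mellin \<phi> field_differentiable at w"
proof -
  \<comment> \<open>With this choice w - 2\<delta> has real part exactly \<open>c\<close>, the last
    abscissa at which \<open>conv\<close> is assumed.\<close>
  define \<delta> where "\<delta> = (Re w - c) / 2"
  have \<delta>: "\<delta> > 0" using w by (simp add: \<delta>_def)
  have d2: "Re (w + of_real (2 * \<delta>)) \<ge> c" "Re (w + of_real (- 2 * \<delta>)) \<ge> c"
    using w by (simp_all add: \<delta>_def field_simps)
  define I where "I w x = indicator {0<..} x *\<^sub>R (complex_of_real x powr (w - 1) * \<phi> x)" for w x
  define D where "D x = complex_of_real (ln x) * I w x" for x
  have I_meas [measurable]: "I w \<in> borel_measurable borel" for w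
    using mellin_integrand_measurable[OF cont, of w] unfolding I_def set_borel_measurable_def .
  have I_int: "integrable lborel (I v)" if "Re v \<ge> c" for v
    using conv[OF that] unfolding mellin_converges_def set_integrable_def I_def .
  have mel: "mellin \<phi> v = (\<integral>x. I v x \<partial>lborel)" for v
    unfolding mellin_def set_lebesgue_integral_def I_def ..
  have shift: "I (w + h) x = exp (h * of_real (ln x)) * I w x" for h x
  proof (cases "x > 0")
    case True
    have "complex_of_real x powr (w + h - 1) = complex_of_real x powr (w - 1) * complex_of_real x powr h"
      by (simp add: powr_add[symmetric] algebra_simps)
    also have "complex_of_real x powr h = exp (h * of_real (ln x))"
      using True by (simp add: powr_def Ln_of_real)
    finally show ?thesis by (simp add: I_def mult_ac)
  qed (simp add: I_def)
  define W where "W x = 1 / \<delta> * (norm (I (w + of_real (2 * \<delta>)) x) + norm (I (w + of_real (- 2 * \<delta>)) x))" for x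
  \<comment> \<open>Restricting the limit to a ball makes every term of a test sequence obey the
    majorant; since the ball is open, the restriction is dropped at the end.\<close>
  have "((\<lambda>h. (mellin \<phi> (w + h) - mellin \<phi> w) / h) \<longlongrightarrow> (\<integral>x. D x \<partial>lborel)) (at 0 within ball 0 \<delta>)"
    unfolding tendsto_at_iff_sequentially
  proof (intro allI impI)
    fix X :: "nat \<Rightarrow> complex"
    assume X: "\<forall>i. X i \<in> ball 0 \<delta> - {0}" and X0: "X \<longlonglongrightarrow> 0"
    have Xn: "X i \<noteq> 0" "norm (X i) < \<delta>" for i using X[rule_format, of i] by auto
    have eq: "(mellin \<phi> (w + X i) - mellin \<phi> w) / X i
        = (\<integral>x. (exp (X i * of_real (ln x)) - 1) / X i * I w x \<partial>lborel)" for i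
    proof -
      have "\<bar>Re (X i)\<bar> < \<delta>" using abs_Re_le_cmod[of "X i"] Xn(2)[of i] by linarith
      hence "Re (w + X i) \<ge> c" using w \<delta> unfolding \<delta>_def by (simp add: abs_less_iff field_simps)
      hence "mellin \<phi> (w + X i) - mellin \<phi> w = (\<integral>x. I (w + X i) x - I w x \<partial>lborel)"
        unfolding mel using w by (subst Bochner_Integration.integral_diff) (auto intro!: I_int)
      hence "(mellin \<phi> (w + X i) - mellin \<phi> w) / X i = (\<integral>x. (I (w + X i) x - I w x) / X i \<partial>lborel)"
        by simp
      also have "(\<lambda>x. (I (w + X i) x - I w x) / X i) = (\<lambda>x. (exp (X i * of_real (ln x)) - 1) / X i * I w x)"
        unfolding shift by (simp add: fun_eq_iff algebra_simps diff_divide_distrib)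
      finally show ?thesis .
    qed
    have "(\<lambda>i. \<integral>x. (exp (X i * of_real (ln x)) - 1) / X i * I w x \<partial>lborel) \<longlonglongrightarrow> (\<integral>x. D x \<partial>lborel)"
    proof (rule integral_dominated_convergence[where w = W])
      show "D \<in> borel_measurable lborel" unfolding D_def by measurable
      show "(\<lambda>x. (exp (X i * of_real (ln x)) - 1) / X i * I w x) \<in> borel_measurable lborel" for i
        by measurable
      show "integrable lborel W" unfolding W_def
        by (intro integrable_mult_right Bochner_Integration.integrable_add integrable_norm I_int d2)
      show "AE x in lborel. (\<lambda>i. (exp (X i * of_real (ln x)) - 1) / X i * I w x) \<longlonglongrightarrow> D x"
      proof (rule AE_I2)
        fix x
        have "((\<lambda>h. exp (h * complex_of_real (ln x))) has_field_derivative of_real (ln x)) (at 0)"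
          by (auto intro!: derivative_eq_intros)
        hence "((\<lambda>h. (exp (h * complex_of_real (ln x)) - 1) / h) \<longlongrightarrow> of_real (ln x)) (at 0)"
          by (simp add: has_field_derivative_iff)
        hence "(\<lambda>i. (exp (X i * complex_of_real (ln x)) - 1) / X i) \<longlonglongrightarrow> of_real (ln x)"
          using Xn X0 unfolding tendsto_at_iff_sequentially by (auto simp: o_def)
        thus "(\<lambda>i. (exp (X i * of_real (ln x)) - 1) / X i * I w x) \<longlonglongrightarrow> D x"
          unfolding D_def by (intro tendsto_intros)
      qed
      show "AE x in lborel. norm ((exp (X i * of_real (ln x)) - 1) / X i * I w x) \<le> W x" for i
      proof (rule AE_I2)
        fix x
        have "norm ((exp (X i * of_real (ln x)) - 1) / X i) \<le> 1 / \<delta> * (exp (2 * \<delta> * ln x) + exp (- 2 * \<delta> * ln x))"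
          using Xn[of i] by (intro norm_exp_quotient_le) auto
        hence "norm ((exp (X i * of_real (ln x)) - 1) / X i) * norm (I w x)
            \<le> 1 / \<delta> * (exp (2 * \<delta> * ln x) + exp (- 2 * \<delta> * ln x)) * norm (I w x)"
          by (intro mult_right_mono) auto
        also have "\<dots> = W x"
          unfolding W_def shift norm_mult norm_exp_eq_Re by (simp add: algebra_simps)
        finally show "norm ((exp (X i * of_real (ln x)) - 1) / X i * I w x) \<le> W x"
          by (simp only: norm_mult)
      qed
    qed
    thus "((\<lambda>h. (mellin \<phi> (w + h) - mellin \<phi> w) / h) \<circ> X) \<longlonglongrightarrow> (\<integral>x. D x \<partial>lborel)"
      unfolding o_def eq .
  qed
  hence "((\<lambda>h. (mellin \<phi> (w + h) - mellin \<phi> w) / h) \<longlongrightarrow> (\<integral>x. D x \<partial>lborel)) (at 0)"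
    using \<delta> at_within_open[of "0::complex" "ball 0 \<delta>"] by simp
  thus ?thesis unfolding field_differentiable_def DERIV_def by blast
qed

subsection \<open>Commutation with the Bessel operator\<close>

text \<open>\<open>\<kappa>\<close> is integrable only against u^(-s). But for x > m the factor
  g(xu) vanishes once u \<ge> b/m, and below that 1 \<le> (b/m)^s u^(-s), so a multiple of the
  weighted kernel dominates locally uniformly in x.\<close>

lemma continuous_on_dil_conv:
  fixes \<kappa> :: "real \<Rightarrow> real" and g :: "real \<Rightarrow> complex"
  assumes \<kappa>: "set_integrable lborel {1<..} (\<lambda>u. u powr (- s) * \<kappa> u)" and s: "s \<ge> 0"
    and [measurable]: "\<kappa> \<in> borel_measurable borel"
    and cont: "continuous_on {0<..} g" and b: "b > 0" and zero: "\<And>x. x \<ge> b \<Longrightarrow> g x = 0"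
    and bound: "\<And>x. x > 0 \<Longrightarrow> norm (g x) \<le> C"
  shows "continuous_on {0<..} (dil_conv \<kappa> g)"
proof -
  have C: "C \<ge> 0" using bound[of 1] norm_ge_zero[of "g 1"] by linarith
  \<comment> \<open>\<open>g\<close> is arbitrary on nonpositive arguments, possibly not measurable;
    cutting it off there does not affect g(xu) for x > 0, u > 1.\<close>
  define g0 where "g0 x = indicator {0<..} x *\<^sub>R g x" for x
  have [measurable]: "g0 \<in> borel_measurable borel"
    unfolding g0_def by (intro borel_measurable_continuous_on_indicator cont) auto
  define J where "J x u = indicator {1<..} u *\<^sub>R (complex_of_real (\<kappa> u) * g (x * u))" for x u
  have J_meas: "J x \<in> borel_measurable lborel" if "x > 0" for x
  proof -
    have "J x = (\<lambda>u. indicator {1<..} u *\<^sub>R (complex_of_real (\<kappa> u) * g0 (x * u)))"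
      using that by (auto simp: J_def g0_def fun_eq_iff indicator_def)
    thus ?thesis by simp
  qed
  have *: "continuous_on {m<..} (dil_conv \<kappa> g)" if m: "m > 0" for m
  proof (rule continuous_on_sequentiallyI)
    fix X :: "nat \<Rightarrow> real" and y
    assume X: "\<forall>n. X n \<in> {m<..}" and y: "y \<in> {m<..}" and lim: "X \<longlonglongrightarrow> y"
    show "(\<lambda>n. dil_conv \<kappa> g (X n)) \<longlonglongrightarrow> dil_conv \<kappa> g y"
      unfolding dil_conv_def set_lebesgue_integral_def J_def[symmetric]
    proof (rule integral_dominated_convergence)
      have Xm: "X n > m" for n using X by auto
      show "J y \<in> borel_measurable lborel" using y m by (intro J_meas) auto
      show "J (X n) \<in> borel_measurable lborel" for n using Xm[of n] m by (intro J_meas) auto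
      show "integrable lborel (\<lambda>u. (C * (b / m) powr s) *\<^sub>R norm (indicator {1<..} u *\<^sub>R (u powr (- s) * \<kappa> u)))"
        using \<kappa> unfolding set_integrable_def by (intro integrable_scaleR_right integrable_norm)
      show "AE u in lborel. (\<lambda>n. J (X n) u) \<longlonglongrightarrow> J y u"
      proof (rule AE_I2)
        fix u :: real
        show "(\<lambda>n. J (X n) u) \<longlonglongrightarrow> J y u"
        proof (cases "u > 1")
          case True
          have "isCont g (y * u)" using cont y m True
            by (auto simp: continuous_on_eq_continuous_at)
          moreover have "(\<lambda>n. X n * u) \<longlonglongrightarrow> y * u" by (intro tendsto_intros lim)
          ultimately have "(\<lambda>n. g (X n * u)) \<longlonglongrightarrow> g (y * u)" by (rule isCont_tendsto_compose)
          thus ?thesis unfolding J_def by (intro tendsto_intros)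
        qed (simp add: J_def)
      qed
      show "AE u in lborel. norm (J (X n) u)
          \<le> (C * (b / m) powr s) *\<^sub>R norm (indicator {1<..} u *\<^sub>R (u powr (- s) * \<kappa> u))" for n
      proof (rule AE_I2)
        fix u :: real
        show "norm (J (X n) u)
          \<le> (C * (b / m) powr s) *\<^sub>R norm (indicator {1<..} u *\<^sub>R (u powr (- s) * \<kappa> u))"
        proof (cases "u > 1 \<and> X n * u < b")
          case True
          have "m * u < b" using True Xm[of n] mult_strict_right_mono[of m "X n" u] by linarith
          hence "u \<le> b / m" using m by (simp add: field_simps)
          hence "u powr s \<le> (b / m) powr s" using True s by (intro powr_mono2) auto
          hence "1 \<le> (b / m) powr s * u powr (- s)" using True by (simp add: powr_minus field_simps)
          hence le: "C * \<bar>\<kappa> u\<bar> \<le> (b / m) powr s * u powr (- s) * (C * \<bar>\<kappa> u\<bar>)"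
            using C mult_right_mono[of 1 _ "C * \<bar>\<kappa> u\<bar>"] by simp
          have "norm (J (X n) u) = \<bar>\<kappa> u\<bar> * norm (g (X n * u))"
            using True by (simp add: J_def norm_mult)
          also have "\<dots> \<le> \<bar>\<kappa> u\<bar> * C"
            using bound[of "X n * u"] Xm[of n] m True by (intro mult_left_mono) auto
          also have "\<dots> \<le> (b / m) powr s * u powr (- s) * (C * \<bar>\<kappa> u\<bar>)" using le by (simp add: mult_ac)
          finally show ?thesis using True by (simp add: abs_mult mult_ac)
        next
          case False
          hence "J (X n) u = 0" using zero[of "X n * u"] by (auto simp: J_def indicator_def)
          thus ?thesis using C by simp
        qed
      qed
    qed
  qed
  have "isCont (dil_conv \<kappa> g) x" if "x > 0" for x
    using *[of "x / 2"] that by (auto simp: continuous_on_eq_continuous_at)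
  thus ?thesis by (simp add: continuous_at_imp_continuous_on)
qed

lemma smooth_supported_bounded:
  assumes g: "smooth_supported a b g" and a: "0 < a"
  shows "\<exists>C. \<forall>x>0. norm (g x) \<le> C"
proof -
  have "compact (g ` {a..b})"
    by (intro compact_continuous_image continuous_on_subset[OF smooth_supported_continuous[OF g]])
       (use a in auto)
  then obtain C where C: "\<forall>y \<in> g ` {a..b}. norm y \<le> C"
    using compact_imp_bounded bounded_iff by metis
  have "norm (g x) \<le> max C 0" if "x > 0" for x
    using C g that by (cases "x \<in> {a..b}") (auto simp: smooth_supported_def le_max_iff_disj)
  thus ?thesis by blast
qed

definition bessel_multiplier :: "real \<Rightarrow> real \<Rightarrow> real \<Rightarrow> real" where
  "bessel_multiplier \<nu> \<beta> s = 1 / 2 powr (2 * \<beta>) * (Gamma (s / 2) * Gamma (s / 2 - (\<nu> - 1) / 2) /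
            (Gamma (\<beta> + s / 2 - (\<nu> - 1) / 2) * Gamma (\<beta> + s / 2)))"

text \<open>This is the commutation of B with the fractional integral seen on the Mellin side: the
  quadratic factor in the numerator comes from B acting before the integral, and the denominator
  undoes B afterwards. It is \<Gamma>(z+1) = z \<Gamma>(z) for the four Gamma factors.\<close>

lemma bessel_multiplier_plus_2:
  assumes "\<nu> \<ge> 0" "\<beta> > 0" "s > max 0 (\<nu> - 1)"
  shows "bessel_multiplier \<nu> \<beta> (s + 2) * ((s + 2 * \<beta>) * (s + 2 * \<beta> + 1 - \<nu>)) / (s * (s + 1 - \<nu>))
      = bessel_multiplier \<nu> \<beta> s"
proof -
  define p q where "p = s / 2" and "q = s / 2 - (\<nu> - 1) / 2"
  have pq: "p > 0" "q > 0" using assms by (auto simp: p_def q_def field_simps)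
  have G: "Gamma (x + 1) = x * Gamma x" if "x > 0" for x :: real
    using that by (intro Gamma_plus1) (auto elim!: nonpos_Ints_cases)
  have eqs: "(s + 2) / 2 = p + 1" "p + 1 - (\<nu> - 1) / 2 = q + 1"
    "\<beta> + p + 1 - (\<nu> - 1) / 2 = \<beta> + q + 1" "\<beta> + (p + 1) = \<beta> + p + 1"
    "s / 2 = p" "p - (\<nu> - 1) / 2 = q" "\<beta> + p - (\<nu> - 1) / 2 = \<beta> + q"
    by (simp_all add: p_def q_def field_simps)
  have eqs2: "s = 2 * p" "s + 1 - \<nu> = 2 * q" "s + 2 * \<beta> = 2 * (\<beta> + p)" "s + 2 * \<beta> + 1 - \<nu> = 2 * (\<beta> + q)"
    by (simp_all add: p_def q_def field_simps)
  have pos: "\<beta> + p > 0" "\<beta> + q > 0" using pq assms by auto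
  have alg: "1 / T * (x * p * (y * q) / (u * U * (v * V))) * (2 * v * (2 * u)) / (2 * p * (2 * q)) = 1 / T * (x * y / (U * V))"
    if "u > 0" "v > 0" "p > 0" "q > 0" for T x y u v U V p q :: real
    using that by (simp add: field_simps)
  have m2: "bessel_multiplier \<nu> \<beta> (s + 2) = 1 / 2 powr (2 * \<beta>) * (Gamma p * p * (Gamma q * q)
      / ((\<beta> + q) * Gamma (\<beta> + q) * ((\<beta> + p) * Gamma (\<beta> + p))))"
    unfolding bessel_multiplier_def eqs G[OF pq(1)] G[OF pq(2)] G[OF pos(1)] G[OF pos(2)] by (simp add: mult_ac)
  have m0: "bessel_multiplier \<nu> \<beta> s = 1 / 2 powr (2 * \<beta>) * (Gamma p * Gamma q / (Gamma (\<beta> + q) * Gamma (\<beta> + p)))"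
    unfolding bessel_multiplier_def eqs ..
  have "bessel_multiplier \<nu> \<beta> (s + 2) * ((2 * (\<beta> + p)) * (2 * (\<beta> + q))) / ((2 * p) * (2 * q)) = bessel_multiplier \<nu> \<beta> s"
    unfolding m2 m0 by (rule alg[OF pos(2) pos(1) pq])
  thus ?thesis unfolding eqs2(2,4) unfolding eqs2(3) using eqs2(1) by simp
qed

context
  fixes \<nu> \<beta> a b :: real
  assumes \<nu>: "\<nu> \<ge> 0" and \<beta>: "\<beta> > 0" and a: "0 < a" and b: "a < b"
begin

lemma bessel_integral_zero:
  assumes g: "smooth_supported a b g" and x: "x > 0" "x > b"
  shows "bessel_integral \<nu> \<beta> g x = 0"
proof -
  have "g (x * u) = 0" if "u > 1" for u
  proof -
    have "x * 1 < x * u" using x that by (intro mult_strict_left_mono) auto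
    hence "b < x * u" using x by linarith
    hence "x * u > 0" "x * u \<notin> {a..b}" using a b by auto
    thus ?thesis using g by (simp add: smooth_supported_def)
  qed
  hence "(\<lambda>u. indicator {1<..} u *\<^sub>R (complex_of_real (bessel_kernel \<nu> \<beta> u) * g (x * u))) = (\<lambda>_. 0)"
    by (auto simp: indicator_def)
  thus ?thesis using bessel_integral_eq_dil_conv[OF x(1)]
    by (simp add: dil_conv_def set_lebesgue_integral_def)
qed

text \<open>Supplies vanishing on a closed ray, the form in which the tail-integral and Mellin
  lemmas expect it.\<close>

lemma bessel_integral_zero':
  assumes "smooth_supported a b g" "x \<ge> b + 1"
  shows "bessel_integral \<nu> \<beta> g x = 0"
  using assms a b by (intro bessel_integral_zero) auto

lemma continuous_on_bessel_integral:
  assumes g: "smooth_supported a b g"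
  shows "continuous_on {0<..} (bessel_integral \<nu> \<beta> g)"
proof -
  obtain C where C: "\<And>x. x > 0 \<Longrightarrow> norm (g x) \<le> C" using smooth_supported_bounded[OF g a] by blast
  have "continuous_on {0<..} (dil_conv (bessel_kernel \<nu> \<beta>) g)"
  proof (rule continuous_on_dil_conv)
    \<comment> \<open>Any admissible s would serve; adding 1 to the abscissa picks one.\<close>
    show "set_integrable lborel {1<..} (\<lambda>u. u powr (- ((max 0 (\<nu> - 1) + 1) + 2 * \<beta>)) * bessel_kernel \<nu> \<beta> u)"
      by (rule bessel_kernel_moment(1)[OF \<nu> \<beta>]) simp
    show "g x = 0" if "x \<ge> b + 1" for x
      using g that a b by (auto simp: smooth_supported_def)
    show "norm (g x) \<le> C" if "x > 0" for x using C[OF that] .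
  qed (use \<beta> a b smooth_supported_continuous[OF g] in auto)
  hence "continuous_on {0<..} (\<lambda>x. complex_of_real (x powr (2 * \<beta>)) * dil_conv (bessel_kernel \<nu> \<beta>) g x)"
    by (intro continuous_intros) auto
  thus ?thesis
    by (rule continuous_on_cong[THEN iffD1, rotated -1]) (auto simp: bessel_integral_eq_dil_conv)
qed

lemma mellin_bessel_integral_real:
  assumes g: "smooth_supported a b g" and s: "s > max 0 (\<nu> - 1)"
  shows "mellin_converges (bessel_integral \<nu> \<beta> g) (of_real s)"
    and "mellin (bessel_integral \<nu> \<beta> g) (of_real s)
        = of_real (bessel_multiplier \<nu> \<beta> s) * mellin g (of_real (s + 2 * \<beta>))"
proof -
  note K = bessel_kernel_moment[OF \<nu> \<beta> s]
  have eq: "bessel_integral \<nu> \<beta> g x = of_real (x powr (2 * \<beta>)) * dil_conv (bessel_kernel \<nu> \<beta>) g x"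
    if "x > 0" for x by (rule bessel_integral_eq_dil_conv[OF that])
  have gc: "mellin_converges g (of_real (s + 2 * \<beta>))"
    by (rule smooth_supported_mellin_converges[OF g a])
  show "mellin_converges (bessel_integral \<nu> \<beta> g) (of_real s)"
    using mellin_dil_conv(1)[OF K(1) gc]
    by (subst mellin_converges_cong[OF eq]) (simp_all add: mellin_converges_powr_mult)
  show "mellin (bessel_integral \<nu> \<beta> g) (of_real s)
        = of_real (bessel_multiplier \<nu> \<beta> s) * mellin g (of_real (s + 2 * \<beta>))"
    using mellin_dil_conv(2)[OF K(1) gc] unfolding K(2) bessel_multiplier_def
    by (subst mellin_cong[OF eq]) (simp_all add: mellin_powr_mult)
qed

lemma bessel_integral_mellin_converges_mono:
  assumes "smooth_supported a b g" "mellin_converges (bessel_integral \<nu> \<beta> g) s" "Re s \<le> Re w"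
  shows "mellin_converges (bessel_integral \<nu> \<beta> g) w"
  by (rule mellin_converges_mono[OF continuous_on_bessel_integral[OF assms(1)]
        bessel_integral_zero'[OF assms(1)] assms(2,3)])

lemma bessel_integral_mellin_converges:
  assumes "smooth_supported a b g" "Re s > max 0 (\<nu> - 1)"
  shows "mellin_converges (bessel_integral \<nu> \<beta> g) s"
  using bessel_integral_mellin_converges_mono[OF assms(1) mellin_bessel_integral_real(1)[OF assms]] by simp

text \<open>As B = x^(-\<nu>) D x^\<nu> D, the two nested tails with weights y^(-\<nu>) and z^\<nu>
  form the inverse of B that vanishes for large x. Both sides have equal Mellin transforms by the
  functional equation of the multiplier, and the uniqueness lemma applies because both are
  continuous and vanish for large x.\<close>

lemma bessel_integral_eq_tail_integrals:
  assumes g: "smooth_supported a b g" and x: "x > 0"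
  defines "H \<equiv> bessel_integral \<nu> \<beta> (bessel_op \<nu> g)"
  shows "bessel_integral \<nu> \<beta> g x = tail_integral (\<lambda>y. of_real (y powr (- \<nu>)) *
      tail_integral (\<lambda>z. of_real (z powr \<nu>) * H z) y) x"
proof -
  note Bg = smooth_supported_bessel_op[OF g, of \<nu>]
  define P1 where "P1 z = of_real (z powr \<nu>) * H z" for z
  define P where "P = tail_integral P1"
  define P2 where "P2 y = of_real (y powr (- \<nu>)) * P y" for y
  define h where "h = tail_integral P2"
  have H_cont: "continuous_on {0<..} H" unfolding H_def by (rule continuous_on_bessel_integral[OF Bg])
  have H0: "H y = 0" if "y \<ge> b + 1" for y unfolding H_def by (rule bessel_integral_zero'[OF Bg that])
  have P1_cont: "continuous_on {0<..} P1" unfolding P1_def by (intro continuous_intros H_cont) auto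
  have P1_0: "P1 y = 0" if "y \<ge> b + 1" for y using H0[OF that] by (simp add: P1_def)
  have D_cont: "continuous_on {0<..} (tail_integral \<psi>)"
    if "continuous_on {0<..} \<psi>" "\<And>y. y \<ge> b + 1 \<Longrightarrow> \<psi> y = 0" for \<psi>
  proof -
    have "isCont (tail_integral \<psi>) y" if "y > 0" for y
      using has_vector_derivative_continuous has_vector_derivative_tail_integral[where b = "b + 1"]
        \<open>continuous_on {0<..} \<psi>\<close> \<open>\<And>y. y \<ge> b + 1 \<Longrightarrow> \<psi> y = 0\<close> that by blast
    thus ?thesis by (simp add: continuous_at_imp_continuous_on)
  qed
  have P_cont: "continuous_on {0<..} P" unfolding P_def by (rule D_cont[OF P1_cont P1_0])
  have P_0: "P y = 0" if "y \<ge> b + 1" for y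
    unfolding P_def by (rule tail_integral_zero[OF P1_0 that])
  have P2_cont: "continuous_on {0<..} P2" unfolding P2_def by (intro continuous_intros P_cont) auto
  have P2_0: "P2 y = 0" if "y \<ge> b + 1" for y using P_0[OF that] by (simp add: P2_def)
  have h_cont: "continuous_on {0<..} h" unfolding h_def by (rule D_cont[OF P2_cont P2_0])
  have h_0: "h y = 0" if "y \<ge> b + 1" for y
    unfolding h_def by (rule tail_integral_zero[OF P2_0 that])
  define d where "d y = bessel_integral \<nu> \<beta> g y - h y" for y
  \<comment> \<open>Backwards from s + 2: z^\<nu> passes to s + 2 - \<nu>, the inner tail to s + 1 -
    \<nu> with divisor s + 1 - \<nu>, y^(-\<nu>) to s + 1, the outer tail to s with divisor
    s.\<close>
  have mel: "mellin_converges d (of_real s) \<and> mellin d (of_real s) = 0" if s: "s > max 0 (\<nu> - 1)" for s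
  proof -
    have s2: "s + 2 > max 0 (\<nu> - 1)" and s0: "s > 0" "s + 1 - \<nu> > 0" using s by auto
    have P1m: "mellin_converges P1 (of_real ((s + 1 - \<nu>) + 1))"
      "mellin P1 (of_real ((s + 1 - \<nu>) + 1)) = mellin H (of_real (s + 2))"
      unfolding P1_def mellin_converges_powr_mult mellin_powr_mult
      using mellin_bessel_integral_real(1)[OF Bg s2] by (simp_all add: H_def add_ac)
    have Pm: "mellin_converges P (of_real (s + 1 - \<nu>))"
      "mellin P (of_real (s + 1 - \<nu>)) = mellin H (of_real (s + 2)) / of_real (s + 1 - \<nu>)"
      unfolding P_def using mellin_tail_integral[OF s0(2) P1m(1)] P1m(2) by auto
    have "complex_of_real (s + 1) + of_real (- \<nu>) = of_real (s + 1 - \<nu>)" by simp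
    hence P2m: "mellin_converges P2 (of_real (s + 1))"
      "mellin P2 (of_real (s + 1)) = mellin H (of_real (s + 2)) / of_real (s + 1 - \<nu>)"
      unfolding P2_def mellin_converges_powr_mult mellin_powr_mult using Pm by simp_all
    have hm: "mellin_converges h (of_real s)"
      "mellin h (of_real s) = mellin H (of_real (s + 2)) / of_real (s + 1 - \<nu>) / of_real s"
      unfolding h_def using mellin_tail_integral[OF s0(1) P2m(1)] P2m(2) by auto
    have "mellin H (of_real (s + 2)) = of_real (bessel_multiplier \<nu> \<beta> (s + 2)) * mellin (bessel_op \<nu> g) (of_real (s + 2 * \<beta>) + 2)"
      unfolding H_def mellin_bessel_integral_real(2)[OF Bg s2] by (simp add: add_ac)
    also have "mellin (bessel_op \<nu> g) (of_real (s + 2 * \<beta>) + 2)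
        = of_real (s + 2 * \<beta>) * (of_real (s + 2 * \<beta>) + 1 - of_real \<nu>) * mellin g (of_real (s + 2 * \<beta>))"
      by (rule mellin_bessel_op[OF g a less_imp_le[OF b]])
    finally have "mellin h (of_real s) = of_real (bessel_multiplier \<nu> \<beta> (s + 2) *
        ((s + 2 * \<beta>) * (s + 2 * \<beta> + 1 - \<nu>)) / (s * (s + 1 - \<nu>))) * mellin g (of_real (s + 2 * \<beta>))"
      unfolding hm(2) by (simp add: mult_ac)
    also have "\<dots> = mellin (bessel_integral \<nu> \<beta> g) (of_real s)"
      unfolding bessel_multiplier_plus_2[OF \<nu> \<beta> s] mellin_bessel_integral_real(2)[OF g s] ..
    finally have eq: "mellin h (of_real s) = mellin (bessel_integral \<nu> \<beta> g) (of_real s)" .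
    show ?thesis
      using eq mellin_bessel_integral_real(1)[OF g s] hm(1)
      unfolding mellin_converges_def mellin_def d_def right_diff_distrib by simp
  qed
  have d_cont: "continuous_on {0<..} d"
    unfolding d_def by (intro continuous_intros continuous_on_bessel_integral[OF g] h_cont)
  have d_0: "d y = 0" if "y \<ge> b + 1" for y
    unfolding d_def using bessel_integral_zero'[OF g that] h_0[OF that] by simp
  have "d x = 0"
    by (rule mellin_eq_zero_imp_zero[OF _ d_cont d_0, where ?s0.0 = "max 0 (\<nu> - 1)"]) (use mel x a b in auto)
  thus ?thesis by (simp add: d_def h_def P2_def[abs_def] P_def P1_def[abs_def])
qed

end

section \<open>Powers of the Bessel operator under the fractional integral\<close>

lemma vderiv_cong:
  assumes "\<And>y. y > 0 \<Longrightarrow> F y = G y" "x > 0"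
  shows "vderiv F x = vderiv G x"
proof -
  have "(F has_vector_derivative D) (at x) \<longleftrightarrow> (G has_vector_derivative D) (at x)" for D
    using vderiv_transform(1)[of F G] vderiv_transform(1)[of G F] assms by metis
  thus ?thesis by (simp add: vderiv_def vector_derivative_def)
qed

lemma bessel_op_cong:
  assumes "\<And>y. y > 0 \<Longrightarrow> F y = G y" "x > 0"
  shows "bessel_op \<nu> F x = bessel_op \<nu> G x"
  unfolding bessel_op_def using vderiv_cong[OF assms(1)] vderiv_cong[OF vderiv_cong[OF assms(1)]] assms(2) by simp

text \<open>Continuity of \<open>H\<close> is enough, as each tail integral gains one derivative.
  Through this representation the fractional integral can be differentiated without touching its
  kernel.\<close>

lemma bessel_op_tail_integrals:
  assumes cont: "continuous_on {0<..} H" and zero: "\<And>y. y \<ge> b \<Longrightarrow> H y = 0" and x: "x > 0"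
  shows "bessel_op \<nu> (tail_integral (\<lambda>y. of_real (y powr (- \<nu>)) *
      tail_integral (\<lambda>z. of_real (z powr \<nu>) * H z) y)) x = H x"
proof -
  define P1 where "P1 z = of_real (z powr \<nu>) * H z" for z
  define P where "P = tail_integral P1"
  define P2 where "P2 y = of_real (y powr (- \<nu>)) * P y" for y
  have P1_cont: "continuous_on {0<..} P1" unfolding P1_def by (intro continuous_intros cont) auto
  have P1_0: "P1 y = 0" if "y \<ge> b" for y using zero[OF that] by (simp add: P1_def)
  have P_der: "(P has_vector_derivative - P1 y) (at y)" if "y > 0" for y
    unfolding P_def by (rule has_vector_derivative_tail_integral[OF P1_cont P1_0 that])
  have P_cont: "continuous_on {0<..} P"
    using has_vector_derivative_continuous[OF P_der] by (simp add: continuous_at_imp_continuous_on)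
  have P2_cont: "continuous_on {0<..} P2" unfolding P2_def by (intro continuous_intros P_cont) auto
  have P2_0: "P2 y = 0" if "y \<ge> b" for y
    using tail_integral_zero[OF P1_0 that] by (simp add: P2_def P_def)
  have h1: "vderiv (tail_integral P2) y = - P2 y" if "y > 0" for y
    using has_vector_derivative_tail_integral[OF P2_cont P2_0 that]
    by (simp add: vderiv_def vector_derivative_at)
  have "((\<lambda>y. y powr (- \<nu>)) has_field_derivative (- \<nu>) * x powr (- \<nu> - 1)) (at x)"
    using x by (auto intro!: derivative_eq_intros)
  hence "((\<lambda>y. complex_of_real (y powr (- \<nu>))) has_vector_derivative of_real ((- \<nu>) * x powr (- \<nu> - 1))) (at x)"
    by (intro has_vector_derivative_of_real) (simp add: has_real_derivative_iff_has_vector_derivative)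
  from has_vector_derivative_minus[OF has_vector_derivative_mult[OF this P_der[OF x]]]
  have "((\<lambda>y. - P2 y) has_vector_derivative
      - (of_real (x powr (- \<nu>)) * (- P1 x) + of_real ((- \<nu>) * x powr (- \<nu> - 1)) * P x)) (at x)"
    unfolding P2_def .
  hence h2: "vderiv (vderiv (tail_integral P2)) x
      = - (of_real (x powr (- \<nu>)) * (- P1 x) + of_real ((- \<nu>) * x powr (- \<nu> - 1)) * P x)"
    by (intro vderiv_transform(2)[OF h1 _ x])
  have "x powr (- \<nu>) * x powr \<nu> = 1" using x by (simp flip: powr_add)
  hence e1: "complex_of_real (x powr (- \<nu>)) * of_real (x powr \<nu>) = 1" by (metis of_real_1 of_real_mult)
  have e2: "(- \<nu>) * x powr (- \<nu> - 1) = - (\<nu> / x * x powr (- \<nu>))" using x by (simp add: powr_diff)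
  have "bessel_op \<nu> (tail_integral P2) x = (of_real (x powr (- \<nu>)) * of_real (x powr \<nu>)) * H x"
    unfolding bessel_op_def h2 h1[OF x] e2 P2_def P1_def by (simp add: algebra_simps)
  hence "bessel_op \<nu> (tail_integral P2) x = H x" unfolding e1 by simp
  thus ?thesis by (simp add: P2_def[abs_def] P_def P1_def[abs_def])
qed

lemma bessel_op_bessel_integral:
  assumes "\<nu> \<ge> 0" "\<beta> > 0" "0 < a" "a < b" "smooth_supported a b g" "x > 0"
  shows "bessel_op \<nu> (bessel_integral \<nu> \<beta> g) x = bessel_integral \<nu> \<beta> (bessel_op \<nu> g) x"
  using bessel_op_cong[OF bessel_integral_eq_tail_integrals[OF assms(1-5)] assms(6)]
    bessel_op_tail_integrals[OF continuous_on_bessel_integral[OF assms(1-4) smooth_supported_bessel_op[OF assms(5)]]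
      bessel_integral_zero'[OF assms(1-4) smooth_supported_bessel_op[OF assms(5)]] assms(6)]
  by simp

lemma smooth_supported_bessel_op_funpow:
  "smooth_supported a b g \<Longrightarrow> smooth_supported a b ((bessel_op \<nu> ^^ n) g)"
  by (induction n) (auto intro: smooth_supported_bessel_op)

text \<open>The induction closes because each \<open>(bessel_op \<nu> ^^ n) g\<close> is again
  smooth with support in [a,b], and because B at x > 0 depends only on values on the
  semiaxis.\<close>

lemma bessel_op_funpow_bessel_integral:
  assumes "\<nu> \<ge> 0" "\<beta> > 0" "0 < a" "a < b" "smooth_supported a b g" "x > 0"
  shows "(bessel_op \<nu> ^^ n) (bessel_integral \<nu> \<beta> g) x = bessel_integral \<nu> \<beta> ((bessel_op \<nu> ^^ n) g) x"
  using assms(6)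
proof (induction n arbitrary: x)
  case (Suc n)
  show ?case
    using bessel_op_cong[OF Suc.IH Suc.prems]
      bessel_op_bessel_integral[OF assms(1-4) smooth_supported_bessel_op_funpow[OF assms(5)] Suc.prems]
    by simp
qed simp

text \<open>Each step multiplies by two linear factors; taking 2 out of both gives 4 and the next
  factors of two rising factorials in the half-variables of the Gamma quotient.\<close>

lemma mellin_bessel_op_funpow:
  assumes g: "smooth_supported a b g" and ab: "0 < a" "a \<le> b"
  shows "mellin ((bessel_op \<nu> ^^ n) g) (s + 2 * of_nat n)
      = 4 ^ n * pochhammer (s / 2) n * pochhammer (s / 2 - (of_real \<nu> - 1) / 2) n * mellin g s"
proof (induction n)
  case (Suc n)
  have "mellin ((bessel_op \<nu> ^^ Suc n) g) (s + 2 * of_nat (Suc n))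
      = mellin (bessel_op \<nu> ((bessel_op \<nu> ^^ n) g)) ((s + 2 * of_nat n) + 2)"
    by (simp add: algebra_simps)
  also have "\<dots> = (s + 2 * of_nat n) * (s + 2 * of_nat n + 1 - of_real \<nu>) * mellin ((bessel_op \<nu> ^^ n) g) (s + 2 * of_nat n)"
    by (rule mellin_bessel_op[OF smooth_supported_bessel_op_funpow[OF g] ab])
  also have "(s + 2 * of_nat n) * (s + 2 * of_nat n + 1 - of_real \<nu>)
      = 4 * (s / 2 + of_nat n) * (s / 2 - (of_real \<nu> - 1) / 2 + of_nat n)"
    by (simp add: field_simps)
  finally show ?case unfolding Suc.IH pochhammer_Suc by (simp add: mult_ac)
qed simp

subsection \<open>Analytic continuation and the theorem\<close>

lemma bessel_multiplier_rGamma: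
  fixes s :: real
  assumes "\<nu> \<ge> 0" "\<beta> > 0" "s > max 0 (\<nu> - 1)"
  shows "bessel_multiplier \<nu> \<beta> s * (rGamma (s / 2) * rGamma (s / 2 - (\<nu> - 1) / 2))
      = 1 / 2 powr (2 * \<beta>) * (rGamma (\<beta> + s / 2 - (\<nu> - 1) / 2) * rGamma (\<beta> + s / 2))"
proof -
  have "s / 2 > 0" "s / 2 - (\<nu> - 1) / 2 > 0" using assms by (auto simp: field_simps)
  hence "Gamma (s / 2) > 0" "Gamma (s / 2 - (\<nu> - 1) / 2) > 0" by (auto intro!: Gamma_real_pos)
  thus ?thesis by (simp add: bessel_multiplier_def rGamma_inverse_Gamma field_simps)
qed

text \<open>With reciprocal Gamma functions both sides are holomorphic throughout Re w > Re s, so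
  the identity theorem applies on a connected domain free of poles. The point \<open>s\<close> may
  lie on the boundary line of convergence and is reached as a limit.\<close>

lemma mellin_bessel_integral_rGamma:
  fixes s :: complex
  assumes \<nu>: "\<nu> \<ge> 0" and \<beta>: "\<beta> > 0" and a: "0 < a" and b: "a < b"
    and g: "smooth_supported a b g" and conv: "mellin_converges (bessel_integral \<nu> \<beta> g) s"
  shows "mellin (bessel_integral \<nu> \<beta> g) s * (rGamma (s / 2) * rGamma (s / 2 - (of_real \<nu> - 1) / 2))
      = of_real (1 / 2 powr (2 * \<beta>)) * (rGamma (of_real \<beta> + s / 2 - (of_real \<nu> - 1) / 2) *
          rGamma (of_real \<beta> + s / 2)) * mellin g (s + 2 * of_real \<beta>)"
proof -
  define R where "R w = rGamma (w / 2) * rGamma (w / 2 - (of_real \<nu> - 1) / 2)" for w :: complex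
  define Q where "Q w = of_real (1 / 2 powr (2 * \<beta>)) * (rGamma (of_real \<beta> + w / 2 - (of_real \<nu> - 1) / 2) *
          rGamma (of_real \<beta> + w / 2)) * mellin g (w + 2 * of_real \<beta>)" for w :: complex
  define E where "E w = mellin (bessel_integral \<nu> \<beta> g) w * R w - Q w" for w
  note cont = continuous_on_bessel_integral[OF \<nu> \<beta> a b g]
  note zero = bessel_integral_zero'[OF \<nu> \<beta> a b g]
  have R_holo: "R holomorphic_on UNIV" unfolding R_def by (intro holomorphic_intros) auto
  have "mellin g field_differentiable at w" for w
    by (rule mellin_field_differentiable[OF smooth_supported_continuous[OF g]
          smooth_supported_mellin_converges[OF g a], of "Re w - 1"]) simp
  hence g_holo: "mellin g holomorphic_on UNIV"
    by (simp add: holomorphic_on_def)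
  have "(mellin g \<circ> (\<lambda>w. w + 2 * of_real \<beta>)) holomorphic_on UNIV"
    by (intro holomorphic_on_compose holomorphic_intros holomorphic_on_subset[OF g_holo]) auto
  hence Q_holo: "Q holomorphic_on UNIV"
    unfolding Q_def o_def by (intro holomorphic_intros) auto
  have "mellin (bessel_integral \<nu> \<beta> g) field_differentiable at w" if "Re w > Re s" for w
    by (rule mellin_field_differentiable[OF cont
          bessel_integral_mellin_converges_mono[OF \<nu> \<beta> a b g conv] that])
  hence "mellin (bessel_integral \<nu> \<beta> g) holomorphic_on {w. Re w > Re s}"
    by (auto simp: holomorphic_on_def intro: field_differentiable_at_within)
  hence E_holo: "E holomorphic_on {w. Re w > Re s}"
    unfolding E_def
    by (intro holomorphic_intros holomorphic_on_subset[OF R_holo] holomorphic_on_subset[OF Q_holo]) auto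
  have E_real: "E (of_real t) = 0" if t: "t > max 0 (\<nu> - 1)" for t
  proof -
    have "R (of_real t) = of_real (rGamma (t / 2) * rGamma (t / 2 - (\<nu> - 1) / 2))"
      unfolding R_def by (simp flip: rGamma_complex_of_real)
    hence "mellin (bessel_integral \<nu> \<beta> g) (of_real t) * R (of_real t)
        = of_real (bessel_multiplier \<nu> \<beta> t * (rGamma (t / 2) * rGamma (t / 2 - (\<nu> - 1) / 2))) *
            mellin g (of_real (t + 2 * \<beta>))"
      unfolding mellin_bessel_integral_real(2)[OF \<nu> \<beta> a b g t] by (simp add: mult_ac)
    also have "\<dots> = Q (of_real t)"
      unfolding bessel_multiplier_rGamma[OF \<nu> \<beta> t] Q_def by (simp flip: rGamma_complex_of_real)
    finally show ?thesis by (simp add: E_def)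
  qed
  \<comment> \<open>The ray from \<open>M\<close> lies inside the half-plane Re w > Re s and inside
    the range of the real formula, and its endpoint \<open>M\<close> is a limit point of it.\<close>
  define M where "M = max (Re s) (max 0 (\<nu> - 1)) + 1"
  have E0: "E w = 0" if w: "Re w > Re s" for w
  proof (rule analytic_continuation[OF E_holo])
    show "open {w. Re w > Re s}" by (rule open_halfspace_Re_gt)
    show "connected {w. Re w > Re s}" by (intro convex_connected convex_halfspace_Re_gt)
    show "of_real ` {M..} \<subseteq> {w. Re w > Re s}" by (auto simp: M_def)
    show "of_real M \<in> {w. Re w > Re s}" by (simp add: M_def)
    show "complex_of_real M islimpt of_real ` {M..}"
      unfolding islimpt_approachable
    proof (intro allI impI)
      fix e :: real assume "e > 0"
      hence "complex_of_real (M + e / 2) \<in> of_real ` {M..}"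
        and "complex_of_real (M + e / 2) \<noteq> of_real M \<and> dist (complex_of_real (M + e / 2)) (of_real M) < e"
        by (auto simp: dist_of_real dist_real_def simp del: of_real_add)
      thus "\<exists>x'\<in>complex_of_real ` {M..}. x' \<noteq> of_real M \<and> dist x' (of_real M) < e" by blast
    qed
    show "E z = 0" if z: "z \<in> of_real ` {M..}" for z
    proof -
      obtain t where t: "z = of_real t" "t \<ge> M" using z by auto
      have "t > max 0 (\<nu> - 1)" using t(2) unfolding M_def by linarith
      thus ?thesis using E_real t(1) by simp
    qed
    show "w \<in> {w. Re w > Re s}" using w by simp
  qed
  define S where "S n = s + complex_of_real (1 / real (Suc n))" for n
  have S_lim: "S \<longlonglongrightarrow> s"
    unfolding S_def using tendsto_add[OF tendsto_const tendsto_of_real[OF LIMSEQ_Suc[OF lim_1_over_n]], of s]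
    by simp
  have cont_at: "isCont F s" if "F holomorphic_on UNIV" for F :: "complex \<Rightarrow> complex"
    using holomorphic_on_imp_continuous_on[OF that] by (simp add: continuous_on_eq_continuous_at)
  have M_lim: "(\<lambda>n. mellin (bessel_integral \<nu> \<beta> g) (S n)) \<longlonglongrightarrow> mellin (bessel_integral \<nu> \<beta> g) s"
    unfolding S_def by (rule mellin_tendsto_boundary[OF cont zero conv])
  have "(\<lambda>n. E (S n)) \<longlonglongrightarrow> E s"
    unfolding E_def
    by (intro tendsto_intros M_lim isCont_tendsto_compose[OF cont_at[OF R_holo] S_lim]
          isCont_tendsto_compose[OF cont_at[OF Q_holo] S_lim])
  moreover have "E (S n) = 0" for n by (intro E0) (simp add: S_def)
  ultimately have "E s = 0" using LIMSEQ_unique[OF _ tendsto_const] by simp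
  thus ?thesis by (simp add: E_def R_def Q_def)
qed

text \<open>A divergent integral has the default value 0, so the formulas are asserted where the
  Mellin integral converges and no numerator factor has a pole; the first part guarantees a
  half-plane of such convergence for both transforms.\<close>

theorem mainTheorem6:
  fixes \<nu> \<alpha> a b :: real and n :: nat and f :: "real \<Rightarrow> complex"
  assumes "\<nu> \<ge> 0" and "\<alpha> > 0" and "real n > \<alpha>"
    and "0 < a" and "a < b"
    and "smooth_on_semiaxis f"
    and "closure (support_on {0<..} f) = {a..b}"
  shows "(\<forall>s. Re s > max 0 (\<nu> - 1) \<longrightarrow>
           mellin_converges (bessel_integral \<nu> \<alpha> f) s \<and>
           mellin_converges (bessel_derivative n \<nu> \<alpha> f) s) \<and>
         (\<forall>s. s / 2 \<notin> \<int>\<^sub>\<le>\<^sub>0 \<and> s / 2 - (of_real \<nu> - 1) / 2 \<notin> \<int>\<^sub>\<le>\<^sub>0 \<and>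
           mellin_converges (bessel_integral \<nu> \<alpha> f) s \<longrightarrow>
           mellin (bessel_integral \<nu> \<alpha> f) s =
             of_real (1 / 2 powr (2 * \<alpha>)) *
             ((Gamma (s / 2) * Gamma (s / 2 - (of_real \<nu> - 1) / 2)) /
              (Gamma (of_real \<alpha> + s / 2 - (of_real \<nu> - 1) / 2) * Gamma (of_real \<alpha> + s / 2))) *
             mellin f (2 * of_real \<alpha> + s)) \<and>
         (\<forall>s. s / 2 \<notin> \<int>\<^sub>\<le>\<^sub>0 \<and> s / 2 - (of_real \<nu> - 1) / 2 \<notin> \<int>\<^sub>\<le>\<^sub>0 \<and>
           mellin_converges (bessel_derivative n \<nu> \<alpha> f) s \<longrightarrow>
           mellin (bessel_derivative n \<nu> \<alpha> f) s =
             of_real (2 powr (2 * \<alpha>)) *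
             ((Gamma (s / 2) * Gamma (s / 2 - (of_real \<nu> - 1) / 2)) /
              (Gamma (s / 2 - of_real \<alpha> - (of_real \<nu> - 1) / 2) * Gamma (s / 2 - of_real \<alpha>))) *
             mellin f (s - 2 * of_real \<alpha>))"
proof -
  note \<nu> = assms(1) and \<alpha> = assms(2) and a = assms(4) and b = assms(5)
  define \<beta> where "\<beta> = real n - \<alpha>"
  define g where "g = (bessel_op \<nu> ^^ n) f"
  have \<beta>: "\<beta> > 0" using assms(3) by (simp add: \<beta>_def)
  have "f x = 0" if "x > 0" "x \<notin> {a..b}" for x
    using that assms(7) closure_subset[of "support_on {0<..} f"] by (auto simp: in_support_on)
  hence f: "smooth_supported a b f" using assms(6) by (simp add: smooth_supported_def)
  have g: "smooth_supported a b g"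
    unfolding g_def by (rule smooth_supported_bessel_op_funpow[OF f])
  have deriv_eq: "bessel_derivative n \<nu> \<alpha> f x = bessel_integral \<nu> \<beta> g x" if "x > 0" for x
    unfolding bessel_derivative_def g_def \<beta>_def[symmetric]
    by (rule bessel_op_funpow_bessel_integral[OF \<nu> \<beta> a b f that])
  have deriv_conv: "mellin_converges (bessel_derivative n \<nu> \<alpha> f) w \<longleftrightarrow> mellin_converges (bessel_integral \<nu> \<beta> g) w" for w
    by (rule mellin_converges_cong[OF deriv_eq])
  have deriv_mellin: "mellin (bessel_derivative n \<nu> \<alpha> f) w = mellin (bessel_integral \<nu> \<beta> g) w" for w
    by (rule mellin_cong[OF deriv_eq])
  \<comment> \<open>Only \<open>p\<close> and \<open>q\<close> must avoid poles. At a pole of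
    \<open>Gamma u\<close> or \<open>Gamma v\<close> both the reciprocal Gamma factor and the
    quotient by 0 are 0, so the two forms still agree.\<close>
  have Gamma_form: "X = c * ((Gamma p * Gamma q) / (Gamma u * Gamma v)) * Y"
    if "p \<notin> \<int>\<^sub>\<le>\<^sub>0" "q \<notin> \<int>\<^sub>\<le>\<^sub>0" "X * (rGamma p * rGamma q) = c * (rGamma u * rGamma v) * Y"
    for X Y c p q u v :: complex
  proof -
    have "Gamma p \<noteq> 0" "Gamma q \<noteq> 0" using that by (auto simp: Gamma_eq_zero_iff)
    hence "X = X * (rGamma p * rGamma q) * (Gamma p * Gamma q)"
      by (simp add: rGamma_inverse_Gamma field_simps)
    also have "\<dots> = c * (rGamma u * rGamma v) * Y * (Gamma p * Gamma q)" using that(3) by simp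
    also have "\<dots> = c * ((Gamma p * Gamma q) / (Gamma u * Gamma v)) * Y"
      by (simp add: rGamma_inverse_Gamma divide_inverse mult_ac)
    finally show ?thesis .
  qed
  show ?thesis
  proof (intro conjI allI impI)
    fix s :: complex assume s: "Re s > max 0 (\<nu> - 1)"
    show "mellin_converges (bessel_integral \<nu> \<alpha> f) s"
      by (rule bessel_integral_mellin_converges[OF \<nu> \<alpha> a b f s])
    show "mellin_converges (bessel_derivative n \<nu> \<alpha> f) s"
      using bessel_integral_mellin_converges[OF \<nu> \<beta> a b g s] by (simp only: deriv_conv)
  next
    fix s :: complex
    assume s: "s / 2 \<notin> \<int>\<^sub>\<le>\<^sub>0 \<and> s / 2 - (of_real \<nu> - 1) / 2 \<notin> \<int>\<^sub>\<le>\<^sub>0 \<and>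
      mellin_converges (bessel_integral \<nu> \<alpha> f) s"
    show "mellin (bessel_integral \<nu> \<alpha> f) s = of_real (1 / 2 powr (2 * \<alpha>)) *
             ((Gamma (s / 2) * Gamma (s / 2 - (of_real \<nu> - 1) / 2)) /
              (Gamma (of_real \<alpha> + s / 2 - (of_real \<nu> - 1) / 2) * Gamma (of_real \<alpha> + s / 2))) *
             mellin f (2 * of_real \<alpha> + s)"
      unfolding add.commute[of "2 * of_real \<alpha>" s]
      using s by (intro Gamma_form mellin_bessel_integral_rGamma[OF \<nu> \<alpha> a b f]) auto
  next
    fix s :: complex
    assume s: "s / 2 \<notin> \<int>\<^sub>\<le>\<^sub>0 \<and> s / 2 - (of_real \<nu> - 1) / 2 \<notin> \<int>\<^sub>\<le>\<^sub>0 \<and>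
      mellin_converges (bessel_derivative n \<nu> \<alpha> f) s"
    define u v where "u = s / 2 - of_real \<alpha> - (of_real \<nu> - 1) / 2" and "v = s / 2 - of_real \<alpha>"
    have "mellin (bessel_integral \<nu> \<beta> g) s * (rGamma (s / 2) * rGamma (s / 2 - (of_real \<nu> - 1) / 2))
      = of_real (1 / 2 powr (2 * \<beta>)) * (rGamma (of_real \<beta> + s / 2 - (of_real \<nu> - 1) / 2) *
          rGamma (of_real \<beta> + s / 2)) * mellin g (s + 2 * of_real \<beta>)"
      using s by (intro mellin_bessel_integral_rGamma[OF \<nu> \<beta> a b g]) (simp add: deriv_conv)
    also have "mellin g (s + 2 * of_real \<beta>)
        = 4 ^ n * pochhammer v n * pochhammer u n * mellin f (s - 2 * of_real \<alpha>)"
    proof -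
      have e1: "s + 2 * of_real \<beta> = (s - 2 * of_real \<alpha>) + 2 * of_nat n" by (simp add: \<beta>_def)
      have e2: "(s - 2 * of_real \<alpha>) / 2 = v" "v - (of_real \<nu> - 1) / 2 = u"
        by (simp_all add: u_def v_def field_simps)
      show ?thesis
        unfolding g_def e1 mellin_bessel_op_funpow[OF f a less_imp_le[OF b]] e2 by (rule refl)
    qed
    also have "of_real \<beta> + s / 2 - (of_real \<nu> - 1) / 2 = u + of_nat n" by (simp add: u_def \<beta>_def)
    also have "of_real \<beta> + s / 2 = v + of_nat n" by (simp add: v_def \<beta>_def)
    \<comment> \<open>Here \<open>n\<close> disappears: \<open>pochhammer v n\<close> times
      \<open>rGamma (v + of_nat n)\<close> is \<open>rGamma v\<close>, likewise for
      \<open>u\<close>. The remaining constant is 2^(-2(n-\<alpha>)) 4^n = 2^(2\<alpha>).\<close>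
    also have "complex_of_real (1 / 2 powr (2 * \<beta>)) * (rGamma (u + of_nat n) * rGamma (v + of_nat n)) *
          (4 ^ n * pochhammer v n * pochhammer u n * mellin f (s - 2 * of_real \<alpha>))
        = (complex_of_real (1 / 2 powr (2 * \<beta>)) * 4 ^ n) * (rGamma u * rGamma v) * mellin f (s - 2 * of_real \<alpha>)"
      unfolding pochhammer_rGamma[of u n] pochhammer_rGamma[of v n] by (simp add: mult_ac)
    also have "complex_of_real (1 / 2 powr (2 * \<beta>)) * 4 ^ n = of_real (2 powr (2 * \<alpha>))"
    proof -
      have "(4::real) ^ n = 2 powr (2 * real n)" by (simp add: powr_realpow flip: powr_powr)
      hence "1 / 2 powr (2 * \<beta>) * 4 ^ n = 2 powr (2 * \<alpha>)"
        by (simp add: \<beta>_def powr_diff algebra_simps)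
      thus ?thesis by (metis of_real_mult of_real_numeral of_real_power)
    qed
    finally show "mellin (bessel_derivative n \<nu> \<alpha> f) s = of_real (2 powr (2 * \<alpha>)) *
             ((Gamma (s / 2) * Gamma (s / 2 - (of_real \<nu> - 1) / 2)) /
              (Gamma (s / 2 - of_real \<alpha> - (of_real \<nu> - 1) / 2) * Gamma (s / 2 - of_real \<alpha>))) *
             mellin f (s - 2 * of_real \<alpha>)"
      unfolding deriv_mellin u_def[symmetric] unfolding v_def[symmetric]
      using s by (intro Gamma_form) auto
  qed
qed

end
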